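(* Let $D$ be a selfadjoint operator in a Hilbert space $H$ with orthonormal eigenvectors $e_n$, $n\in\mathbb{N}=\{1,2,\dots\}$, forming a basis of $H$, and corresponding eigenvalues $\mu_n=n$. Let $R$ be a bounded selfadjoint non-compact operator on $H$ with matrix $R_{ij}=(Re_j,e_i)$ such that $$\lim_{n\to\infty}R_{n,n+p}=0\quad\text{for every }p\in\mathbb{Z}.$$ Then the selfadjoint operator $T=D+R$ has discrete spectrum, and its eigenvalues $\lambda_n$ satisfy, as $n\to\infty$, $$\lambda_n=n+R_{nn}+\sum_{k\ne n}\frac{|R_{nk}|^2}{n-k}+O\left((\Delta_n+\|Ke_n\|)\,(|R_{nn}|+\|Ke_n\|)\right),$$ where $$\|Ke_n\|^2=\sum_{k\ne n}\frac{|R_{kn}|^2}{(k-n)^2},$$ and $(\Delta_n)$ is a sequence of nonnegative numbers satisfying $$\Delta_n^2=O\left(\sum_{m=1}^{\infty}\frac{(|R_{mm}|+\|Ke_m\|)^2}{\|(D-nE-\tfrac12E_n)e_m\|^2}\right).$$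
   Context: The inner product $(\cdot,\cdot)$ is linear in its first argument. $E$ is the identity operator and $E_n$ is the linear operator with $E_ne_m=e_m$ for $m>n$ and $E_ne_m=-e_m$ for $m\le n$. $K$ is the operator with matrix $K_{ij}=R_{ij}/(i-j)$ for $i\ne j$ and $K_{ii}=0$ in the basis $\{e_n\}$, so that $\|Ke_n\|$ is given by the formula in the claim. All sums over $k\neq n$ run over $k\in\mathbb{N}$, $k\ne n$. Convention: the eigenvalues $\lambda_1\le\lambda_2\le\dots$ of $T$ are numbered in nondecreasing order with multiplicity. *)

theory Defs
  imports "HOL-Analysis.Analysis" "HOL-Library.Landau_Symbols"
begin

section \<open>Complex Hilbert spaces\<close>

text \<open>
  The distribution only has real inner product spaces. The inner product is linear in its first
  argument, and the real scalar multiplication and the norm of the underlying Banach space are those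
  induced by the complex structure. Completeness comes from the class \<^class>\<open>banach\<close>.
\<close>

class chilbert_space = banach +
  fixes scaleC :: "complex \<Rightarrow> 'a \<Rightarrow> 'a"  (infixr "*\<^sub>C" 75)
    and cinner :: "'a \<Rightarrow> 'a \<Rightarrow> complex"
  assumes scaleC_add_right: "c *\<^sub>C (x + y) = c *\<^sub>C x + c *\<^sub>C y"
    and scaleC_add_left: "(c + d) *\<^sub>C x = c *\<^sub>C x + d *\<^sub>C x"
    and scaleC_scaleC: "c *\<^sub>C d *\<^sub>C x = (c * d) *\<^sub>C x"
    and scaleC_of_real: "complex_of_real r *\<^sub>C x = r *\<^sub>R x"
    and cinner_add_left: "cinner (x + y) z = cinner x z + cinner y z"
    and cinner_scaleC_left: "cinner (c *\<^sub>C x) y = c * cinner x y"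
    and cinner_commute: "cinner x y = cnj (cinner y x)"
    and cinner_self: "cinner x x = complex_of_real ((norm x)\<^sup>2)"

global_interpretation complex_vector: vector_space "scaleC :: complex \<Rightarrow> 'a \<Rightarrow> 'a::chilbert_space"
  defines csubspace = complex_vector.subspace
    and cspan = complex_vector.span
    and cdim = complex_vector.dim
proof
  fix x :: 'a
  show "1 *\<^sub>C x = x"
    using scaleC_of_real[of 1 x] by simp
qed (simp_all add: scaleC_add_right scaleC_add_left scaleC_scaleC)

text \<open>The basis vectors are \<open>e 1, e 2, \<dots>\<close>; the value \<open>e 0\<close> is irrelevant.\<close>

definition orthonormal_basis :: "(nat \<Rightarrow> 'a::chilbert_space) \<Rightarrow> bool" where
  "orthonormal_basis e \<longleftrightarrow>
     (\<forall>i\<ge>1. \<forall>j\<ge>1. cinner (e i) (e j) = (if i = j then 1 else 0)) \<and>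
     closure (cspan (e ` {1..})) = UNIV"

definition matrix_entry :: "(nat \<Rightarrow> 'a::chilbert_space) \<Rightarrow> ('a \<Rightarrow> 'a) \<Rightarrow> nat \<Rightarrow> nat \<Rightarrow> complex" where
  "matrix_entry e A i j = cinner (A (e j)) (e i)"

section \<open>Operators\<close>

text \<open>
  A (possibly unbounded) operator is a pair of a domain \<open>S\<close> and a function \<open>A\<close>, of which only the
  values on \<open>S\<close> matter.
\<close>

definition clinear_on :: "'a set \<Rightarrow> ('a \<Rightarrow> 'a::chilbert_space) \<Rightarrow> bool" where
  "clinear_on S A \<longleftrightarrow>
     csubspace S \<and> (\<forall>x\<in>S. \<forall>y\<in>S. A (x + y) = A x + A y) \<and> (\<forall>c. \<forall>x\<in>S. A (c *\<^sub>C x) = c *\<^sub>C A x)"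

definition adjoint_graph :: "'a set \<Rightarrow> ('a \<Rightarrow> 'a::chilbert_space) \<Rightarrow> ('a \<times> 'a) set" where
  "adjoint_graph S A = {(y, z). \<forall>x\<in>S. cinner (A x) y = cinner x z}"

definition selfadjoint_on :: "'a set \<Rightarrow> ('a \<Rightarrow> 'a::chilbert_space) \<Rightarrow> bool" where
  "selfadjoint_on S A \<longleftrightarrow>
     clinear_on S A \<and> closure S = UNIV \<and> adjoint_graph S A = {(y, A y) | y. y \<in> S}"

definition compact_operator :: "('a \<Rightarrow> 'a::chilbert_space) \<Rightarrow> bool" where
  "compact_operator A \<longleftrightarrow> clinear_on UNIV A \<and> compact (closure (A ` cball 0 1))"

section \<open>Spectra\<close>

definition eigenspace :: "'a set \<Rightarrow> ('a \<Rightarrow> 'a::chilbert_space) \<Rightarrow> complex \<Rightarrow> 'a set" where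
  "eigenspace S A z = {x \<in> S. A x = z *\<^sub>C x}"

definition resolvent_set :: "'a set \<Rightarrow> ('a \<Rightarrow> 'a::chilbert_space) \<Rightarrow> complex set" where
  "resolvent_set S A =
     {z. bij_betw (\<lambda>x. A x - z *\<^sub>C x) S UNIV \<and>
         (\<exists>C. \<forall>x\<in>S. norm x \<le> C * norm (A x - z *\<^sub>C x))}"

definition spectrum :: "'a set \<Rightarrow> ('a \<Rightarrow> 'a::chilbert_space) \<Rightarrow> complex set" where
  "spectrum S A = - resolvent_set S A"

text \<open>
  The spectrum consists of isolated eigenvalues of finite multiplicity. For selfadjoint operators
  the algebraic and the geometric multiplicity coincide.
\<close>

definition has_discrete_spectrum :: "'a set \<Rightarrow> ('a \<Rightarrow> 'a::chilbert_space) \<Rightarrow> bool" where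
  "has_discrete_spectrum S A \<longleftrightarrow>
     (\<forall>z\<in>spectrum S A. z isolated_in spectrum S A \<and> eigenspace S A z \<noteq> {0} \<and>
        (\<exists>B. finite B \<and> eigenspace S A z \<subseteq> cspan B))"

text \<open>
  \<open>l 1 \<le> l 2 \<le> \<dots>\<close> lists all eigenvalues, each as often as its multiplicity. Numbers \<open>z\<close> that are
  not eigenvalues have the trivial eigenspace, of dimension \<open>0\<close>, and hence do not occur.
\<close>

definition enumerates_eigenvalues ::
    "(nat \<Rightarrow> real) \<Rightarrow> 'a set \<Rightarrow> ('a \<Rightarrow> 'a::chilbert_space) \<Rightarrow> bool" where
  "enumerates_eigenvalues l S A \<longleftrightarrow>
     mono_on {1..} l \<and>
     (\<forall>z. finite {n\<in>{1..}. complex_of_real (l n) = z} \<and>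
          card {n\<in>{1..}. complex_of_real (l n) = z} = cdim (eigenspace S A z))"

section \<open>The auxiliary operators\<close>

definition K_op :: "(nat \<Rightarrow> 'a) \<Rightarrow> ('a \<Rightarrow> 'a) \<Rightarrow> 'a \<Rightarrow> 'a::chilbert_space" where
  "K_op e R x =
     (\<Sum>\<^sub>\<infinity>i\<in>{1..}. (\<Sum>\<^sub>\<infinity>j\<in>{1..}.
        (if i = j then 0 else matrix_entry e R i j / (of_nat i - of_nat j)) * cinner x (e j)) *\<^sub>C e i)"

text \<open>The reflection that changes the sign of \<open>e 1, \<dots>, e n\<close>.\<close>

definition E_op :: "(nat \<Rightarrow> 'a) \<Rightarrow> nat \<Rightarrow> 'a \<Rightarrow> 'a::chilbert_space" where
  "E_op e n x = x - 2 *\<^sub>R (\<Sum>m=1..n. cinner x (e m) *\<^sub>C e m)"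

lemma E_op_basis:
  assumes "orthonormal_basis e" "m \<ge> 1"
  shows "E_op e n (e m) = (if m > n then e m else - e m)"
proof -
  have "(\<Sum>k=1..n. cinner (e m) (e k) *\<^sub>C e k) = (\<Sum>k=1..n. if k = m then e m else 0)"
    using assms by (intro sum.cong) (auto simp: orthonormal_basis_def)
  also have "\<dots> = (if m > n then 0 else e m)"
    using assms(2) by simp
  finally show ?thesis
    by (simp add: E_op_def scaleR_2)
qed

end

theory Submission
  imports Defs
begin

text \<open>
  Let \<open>G\<close> be the diagonal operator with entries \<open>1 / (\<lambda> - i)\<close>, where \<open>\<lambda>\<close> lies within \<open>1/2\<close> of \<open>n\<close> and
  the entry \<open>i = n\<close> is dropped unless \<open>\<lambda> = n + 1/2\<close>. It is concentrated near \<open>n\<close>, where the matrix of \<open>R\<close>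
  is small because its diagonals tend to \<open>0\<close>; hence the norm of \<open>G R G\<close> tends to \<open>0\<close> as \<open>n\<close> grows.
  An eigenvector at \<open>n + 1/2\<close> would satisfy \<open>x = G R x = G R G R x\<close>, so for large \<open>n\<close> there is none, not
  even for \<open>D + t R\<close> with \<open>0 \<le> t \<le> 1\<close>. As the \<open>n\<close>-th eigenvalue is Lipschitz in \<open>t\<close> and equals \<open>n\<close> at
  \<open>t = 0\<close>, it stays within \<open>1/2\<close> of \<open>n\<close>. Expanding \<open>x = G R x\<close> off \<open>e\<^sub>n\<close> once more gives the eigenvalue
  up to \<open>O(\<parallel>K e\<^sub>n\<parallel>\<^sup>2)\<close>, so that \<open>\<Delta>\<^sub>n = 0\<close> is admissible. Eigenvectors of
  \<open>D + t R\<close> form a basis by the spectral theorem for the compact inverse of \<open>D + t R + c\<close>.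
\<close>

section \<open>Inner products and orthonormal bases\<close>

text \<open>A single factor \<open>G\<close> does not make \<open>R\<close> small: the columns of
  \<open>R\<close> need not tend to 0 in norm, since their mass may move ever further away from the
  diagonal. Only entries at bounded distance from the diagonal become small. A factor
  \<open>G\<close> on each side confines both indices to a window around \<open>n\<close>; the
  window meets finitely many diagonals, and the tails are controlled by the norm of
  \<open>R\<close>. Finding some eigenvalue near each large \<open>n\<close> would not reveal its
  number, because nothing is known about the low part of the spectrum and a few eigenvalues there
  could shift the count. Following the path in \<open>t\<close> settles the numbering. Half-integers
  serve as barriers because they are the midpoints of the gaps in the spectrum of \<open>D\<close>.
  The expansion first yields the sum of |R_nk|^2 / (\<lambda> - k) with the eigenvalue \<lambda>
  itself. Replacing \<lambda> by \<open>n\<close> costs at most the sum of |R_nk|^2 / (n - k)^2, the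
  square of the norm of \<open>K e_n\<close>, so knowing that \<lambda> is within 1/2 of
  \<open>n\<close> suffices.\<close>

lemma cinner_add_right: "cinner x (y + z) = cinner x y + cinner x (z :: 'a::chilbert_space)"
  by (metis cinner_add_left cinner_commute complex_cnj_add)

lemma cinner_scaleC_right: "cinner x (c *\<^sub>C y) = cnj c * cinner x (y :: 'a::chilbert_space)"
  by (metis cinner_commute cinner_scaleC_left complex_cnj_mult)

lemma cinner_scaleR_left: "cinner (r *\<^sub>R x) y = of_real r * cinner x (y :: 'a::chilbert_space)"
  by (metis cinner_scaleC_left scaleC_of_real)

lemma cinner_scaleR_right: "cinner x (r *\<^sub>R y) = of_real r * cinner x (y :: 'a::chilbert_space)"
  by (metis cinner_scaleC_right complex_cnj_complex_of_real scaleC_of_real)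

lemma cinner_minus_left: "cinner (- x) y = - cinner x (y :: 'a::chilbert_space)"
  using cinner_scaleR_left[of "-1" x y] by simp

lemma cinner_minus_right: "cinner x (- y) = - cinner x (y :: 'a::chilbert_space)"
  using cinner_scaleR_right[of x "-1" y] by simp

lemma cinner_diff_left: "cinner (x - y) z = cinner x z - cinner y (z :: 'a::chilbert_space)"
  using cinner_add_left[of x "- y" z] by (simp add: cinner_minus_left)

lemma cinner_diff_right: "cinner x (y - z) = cinner x y - cinner x (z :: 'a::chilbert_space)"
  using cinner_add_right[of x y "- z"] by (simp add: cinner_minus_right)

lemma norm_scaleC: "norm (c *\<^sub>C x) = cmod c * norm (x :: 'a::chilbert_space)"
proof -
  have "complex_of_real ((norm (c *\<^sub>C x))\<^sup>2) = c * cnj c * complex_of_real ((norm x)\<^sup>2)"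
    by (simp only: cinner_self[symmetric] cinner_scaleC_left cinner_scaleC_right ac_simps)
  also have "\<dots> = complex_of_real ((cmod c * norm x)\<^sup>2)"
    by (simp only: complex_norm_square[symmetric] power_mult_distrib of_real_mult)
  finally have "(norm (c *\<^sub>C x))\<^sup>2 = (cmod c * norm x)\<^sup>2"
    by (simp only: of_real_eq_iff)
  then show ?thesis by simp
qed

lemma norm_add_square:
  "(norm (x + y))\<^sup>2 = (norm x)\<^sup>2 + 2 * Re (cinner x y) + (norm (y :: 'a::chilbert_space))\<^sup>2"
proof -
  have "complex_of_real ((norm (x + y))\<^sup>2)
      = of_real ((norm x)\<^sup>2) + cinner x y + cnj (cinner x y) + of_real ((norm y)\<^sup>2)"
    by (simp only: cinner_self[symmetric] cinner_add_left cinner_add_right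
        cinner_commute[symmetric] ac_simps)
  from arg_cong[OF this, of Re] show ?thesis by simp
qed

lemma norm_diff_square:
  "(norm (x - y))\<^sup>2 = (norm x)\<^sup>2 - 2 * Re (cinner x y) + (norm (y :: 'a::chilbert_space))\<^sup>2"
  using norm_add_square[of x "- y"] by (simp add: cinner_minus_right)

lemma norm_cinner_le: "cmod (cinner x y) \<le> norm x * norm (y :: 'a::chilbert_space)"
proof (cases "y = 0")
  case True
  then show ?thesis using cinner_diff_right[of x y y] by simp
next
  case False
  \<comment> \<open>\<open>?c\<close> is the coefficient of the orthogonal projection of
    \<open>x\<close> onto \<open>y\<close>; Cauchy-Schwarz says that the remainder has a nonnegative
    squared norm.\<close>
  let ?c = "cinner x y / of_real ((norm y)\<^sup>2)"
  have "cinner x (?c *\<^sub>C y) = of_real ((cmod (cinner x y))\<^sup>2 / (norm y)\<^sup>2)"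
    by (simp add: cinner_scaleC_right complex_norm_square mult.commute del: of_real_power)
  moreover have "(norm (?c *\<^sub>C y))\<^sup>2 = (cmod (cinner x y))\<^sup>2 / (norm y)\<^sup>2"
    using False by (simp add: norm_scaleC norm_divide norm_mult power2_eq_square)
  ultimately have "(norm (x - ?c *\<^sub>C y))\<^sup>2 = (norm x)\<^sup>2 - (cmod (cinner x y))\<^sup>2 / (norm y)\<^sup>2"
    by (simp add: norm_diff_square)
  then have "(cmod (cinner x y))\<^sup>2 / (norm y)\<^sup>2 \<le> (norm x)\<^sup>2"
    by (metis diff_ge_0_iff_ge zero_le_power2)
  then have "(cmod (cinner x y))\<^sup>2 \<le> (norm x * norm y)\<^sup>2"
    using False by (simp add: field_simps)
  then show ?thesis by (rule power2_le_imp_le) simp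
qed

interpretation cinner: bounded_bilinear "cinner :: 'a::chilbert_space \<Rightarrow> 'a \<Rightarrow> complex"
proof
  show "\<exists>K. \<forall>a b :: 'a. cmod (cinner a b) \<le> norm a * norm b * K"
    by (intro exI[of _ 1]) (simp add: norm_cinner_le)
qed (simp_all add: cinner_add_left cinner_add_right cinner_scaleR_left cinner_scaleR_right
      scaleR_conv_of_real)

lemma scaleR_eq_scaleC: "r *\<^sub>R x = complex_of_real r *\<^sub>C (x :: 'a::chilbert_space)"
  by (simp add: scaleC_of_real)

interpretation scaleC: bounded_bilinear "scaleC :: complex \<Rightarrow> 'a \<Rightarrow> 'a::chilbert_space"
proof
  show "\<exists>K. \<forall>a (b :: 'a). norm (a *\<^sub>C b) \<le> norm a * norm b * K"
    by (intro exI[of _ 1]) (simp add: norm_scaleC)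
qed (simp_all add: scaleC_add_left scaleC_add_right scaleR_eq_scaleC scaleC_scaleC
      scaleR_conv_of_real mult.commute)

lemma cinner_self_eq_norm: "Re (cinner x x) = (norm (x :: 'a::chilbert_space))\<^sup>2"
  by (simp add: cinner_self)

section \<open>Orthonormal systems, basis expansion and Parseval's identity\<close>

definition orthonormal_on :: "nat set \<Rightarrow> (nat \<Rightarrow> 'a::chilbert_space) \<Rightarrow> bool" where
  "orthonormal_on I e \<longleftrightarrow> (\<forall>i\<in>I. \<forall>j\<in>I. cinner (e i) (e j) = (if i = j then 1 else 0))"

lemma orthonormal_basis_on: "orthonormal_basis e \<Longrightarrow> F \<subseteq> {1..} \<Longrightarrow> orthonormal_on F e"
  by (auto simp: orthonormal_basis_def orthonormal_on_def subset_iff)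

lemma orthonormal_norm:
  assumes "orthonormal_on I e" "i \<in> I"
  shows "norm (e i) = 1"
proof -
  have "(norm (e i))\<^sup>2 = 1"
    using assms cinner_self_eq_norm[of "e i"] by (simp add: orthonormal_on_def)
  then show ?thesis by (simp add: power2_eq_1_iff) (metis norm_ge_zero not_one_le_zero neg_0_le_iff_le order.trans)
qed

lemma cinner_sum_basis:
  assumes "orthonormal_on F e" "finite F" "j \<in> F"
  shows "cinner (\<Sum>i\<in>F. c i *\<^sub>C e i) (e j) = c j"
proof -
  have "cinner (\<Sum>i\<in>F. c i *\<^sub>C e i) (e j) = (\<Sum>i\<in>F. if i = j then c i else 0)"
    unfolding cinner.sum_left cinner_scaleC_left
    using assms by (intro sum.cong) (auto simp: orthonormal_on_def)
  then show ?thesis using assms by simp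
qed

lemma norm_sum_basis:
  assumes "orthonormal_on F e" "finite F"
  shows "(norm (\<Sum>i\<in>F. c i *\<^sub>C e i))\<^sup>2 = (\<Sum>i\<in>F. (cmod (c i))\<^sup>2)"
proof -
  have "cinner (\<Sum>i\<in>F. c i *\<^sub>C e i) (\<Sum>j\<in>F. c j *\<^sub>C e j) = (\<Sum>j\<in>F. cnj (c j) * c j)"
    unfolding cinner.sum_right cinner_scaleC_right
    using assms by (intro sum.cong) (simp_all add: cinner_sum_basis)
  from arg_cong[OF this, of Re] show ?thesis
    by (simp add: cinner_self_eq_norm cmod_power2) (simp add: power2_eq_square)
qed

text \<open>Bessel's inequality: the projection \<open>?p\<close> satisfies (x, ?p) = (?p, ?p), so
  Pythagoras applies to \<open>x - ?p\<close>.\<close>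

lemma norm_diff_projection_le:
  assumes "orthonormal_on F e" "finite F"
  shows "norm (x - (\<Sum>i\<in>F. cinner x (e i) *\<^sub>C e i)) \<le> norm x"
proof -
  let ?p = "\<Sum>i\<in>F. cinner x (e i) *\<^sub>C e i"
  have "cinner x ?p = (\<Sum>i\<in>F. of_real ((cmod (cinner x (e i)))\<^sup>2))"
    by (simp add: cinner.sum_right cinner_scaleC_right complex_norm_square mult.commute del: of_real_power)
  then have "Re (cinner x ?p) = (norm ?p)\<^sup>2"
    using norm_sum_basis[OF assms, of "\<lambda>i. cinner x (e i)"] by simp
  then have "(norm (x - ?p))\<^sup>2 = (norm x)\<^sup>2 - (norm ?p)\<^sup>2"
    by (simp add: norm_diff_square)
  then have "(norm (x - ?p))\<^sup>2 \<le> (norm x)\<^sup>2" by simp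
  then show ?thesis by (rule power2_le_imp_le) simp
qed

lemma cspan_image_eq:
  assumes "x \<in> cspan (e ` F)" "orthonormal_on F e" "finite F"
  shows "x = (\<Sum>i\<in>F. cinner x (e i) *\<^sub>C e i)"
  using assms(1)
proof (induction rule: complex_vector.span_induct_alt)
  case base
  then show ?case by (simp add: cinner.zero_left)
next
  case (step c y z)
  then obtain j where j: "j \<in> F" "y = e j" by auto
  have "(\<Sum>i\<in>F. cinner (c *\<^sub>C y + z) (e i) *\<^sub>C e i)
      = (\<Sum>i\<in>F. (if i = j then c *\<^sub>C e i else 0)) + (\<Sum>i\<in>F. cinner z (e i) *\<^sub>C e i)"
    unfolding sum.distrib[symmetric] using assms(2) j
    by (intro sum.cong)
      (auto simp: cinner_add_left cinner_scaleC_left orthonormal_on_def scaleC_add_left)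
  also have "\<dots> = c *\<^sub>C y + z"
    using step.IH j assms(3) by simp
  finally show ?case by simp
qed

text \<open>Density gives a finite combination \<open>s\<close> close to \<open>x\<close>.
  Projection onto any finite set of basis vectors containing those of \<open>s\<close> leaves
  \<open>s\<close> fixed, so the remainder of \<open>x\<close> equals the remainder of
  \<open>x - s\<close>, which Bessel bounds. Since this works for all larger finite sets, the
  convergence is unconditional.\<close>

lemma basis_expansion:
  assumes "orthonormal_basis e"
  shows "((\<lambda>i. cinner x (e i) *\<^sub>C e i) has_sum x) {1..}"
  unfolding has_sum_def tendsto_iff eventually_finite_subsets_at_top
proof (intro allI impI)
  fix \<epsilon> :: real assume "\<epsilon> > 0"
  moreover have "x \<in> closure (cspan (e ` {1..}))"
    using assms by (simp add: orthonormal_basis_def)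
  ultimately obtain s where s: "s \<in> cspan (e ` {1..})" "dist s x < \<epsilon>"
    unfolding closure_approachable by blast
  from s(1) obtain t r where t: "finite t" "t \<subseteq> e ` {1..}" "s = (\<Sum>a\<in>t. r a *\<^sub>C a)"
    unfolding complex_vector.span_explicit by blast
  obtain F0 where F0: "finite F0" "F0 \<subseteq> {1..}" "t = e ` F0"
    using finite_subset_image[OF t(1,2)] by blast
  show "\<exists>X. finite X \<and> X \<subseteq> {1..} \<and>
         (\<forall>Y. finite Y \<and> X \<subseteq> Y \<and> Y \<subseteq> {1..} \<longrightarrow> dist (\<Sum>i\<in>Y. cinner x (e i) *\<^sub>C e i) x < \<epsilon>)"
  proof (intro exI conjI allI impI)
    show "finite F0" "F0 \<subseteq> {1..}" by fact+
    fix F assume F: "finite F \<and> F0 \<subseteq> F \<and> F \<subseteq> {1..}"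
    then have on: "orthonormal_on F e" using assms by (simp add: orthonormal_basis_on)
    have "s \<in> cspan (e ` F)"
      unfolding t(3) F0(3)
      using F by (intro complex_vector.span_sum complex_vector.span_scale complex_vector.span_base) auto
    then have "s = (\<Sum>i\<in>F. cinner s (e i) *\<^sub>C e i)"
      using on F by (intro cspan_image_eq) auto
    then have "x - (\<Sum>i\<in>F. cinner x (e i) *\<^sub>C e i)
        = (x - s) - (\<Sum>i\<in>F. cinner (x - s) (e i) *\<^sub>C e i)"
      by (simp add: cinner_diff_left scaleC.diff_left sum_subtractf)
    also have "norm \<dots> \<le> norm (x - s)"
      using on F by (intro norm_diff_projection_le) auto
    finally show "dist (\<Sum>i\<in>F. cinner x (e i) *\<^sub>C e i) x < \<epsilon>"
      using s(2) by (simp add: dist_norm norm_minus_commute)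
  qed
qed

lemma parseval:
  assumes "orthonormal_basis e"
  shows "((\<lambda>i. cinner x (e i) * cnj (cinner y (e i))) has_sum cinner x y) {1..}"
proof -
  have "cinner (cinner x (e i) *\<^sub>C e i) y = cinner x (e i) * cnj (cinner y (e i))" for i
    by (metis cinner_scaleC_left cinner_commute)
  then show ?thesis
    using has_sum_bounded_linear[OF cinner.bounded_linear_left basis_expansion[OF assms], of x y]
    by simp
qed

lemma parseval_norm:
  assumes "orthonormal_basis e"
  shows "((\<lambda>i. (cmod (cinner x (e i)))\<^sup>2) has_sum (norm x)\<^sup>2) {1..}"
proof -
  have "Re (cinner x (e i) * cnj (cinner x (e i))) = (cmod (cinner x (e i)))\<^sup>2" for i
    by (simp add: cmod_power2) (simp add: power2_eq_square)
  then show ?thesis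
    using has_sum_bounded_linear[OF bounded_linear_Re parseval[OF assms, of x x]]
    by (simp add: cinner_self_eq_norm)
qed

lemma basis_eqI:
  assumes "orthonormal_basis e" "\<And>i. i \<ge> 1 \<Longrightarrow> cinner x (e i) = cinner y (e i)"
  shows "x = y"
proof -
  have "((\<lambda>i. cinner x (e i) *\<^sub>C e i) has_sum x) {1..} = ((\<lambda>i. cinner y (e i) *\<^sub>C e i) has_sum x) {1..}"
    using assms(2) by (intro has_sum_cong) simp
  then show ?thesis
    using basis_expansion[OF assms(1)] has_sum_unique by blast
qed

text \<open>By Parseval, a coordinatewise comparison passes to norms. All norm bounds for diagonal
  operators below come from this.\<close>

lemma norm_le_coordinates:
  assumes "orthonormal_basis e" "c \<ge> 0"
    and "\<And>i. i \<ge> 1 \<Longrightarrow> cmod (cinner x (e i)) \<le> c * cmod (cinner y (e i))"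
  shows "norm x \<le> c * norm y"
proof -
  have "(norm x)\<^sup>2 \<le> c\<^sup>2 * (norm y)\<^sup>2"
  proof (rule has_sum_mono[OF parseval_norm[OF assms(1)] has_sum_cmult_right[OF parseval_norm[OF assms(1)]]])
    fix i :: nat assume "i \<in> {1..}"
    then show "(cmod (cinner x (e i)))\<^sup>2 \<le> c\<^sup>2 * (cmod (cinner y (e i)))\<^sup>2"
      using power_mono[OF assms(3)[of i], of 2] by (simp add: power_mult_distrib)
  qed
  then show ?thesis
    using assms(2) by (metis power_mult_distrib power2_le_imp_le mult_nonneg_nonneg norm_ge_zero)
qed

lemma norm_coordinate_le:
  assumes "orthonormal_basis e" "i \<ge> 1"
  shows "cmod (cinner x (e i)) \<le> norm x"
  using norm_cinner_le[of x "e i"] orthonormal_norm[OF orthonormal_basis_on[OF assms(1) order_refl]] assms(2)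
  by simp

lemma cinner_partial_sum:
  assumes "orthonormal_basis e" "finite F" "F \<subseteq> {1..}" "j \<ge> 1"
  shows "cinner (\<Sum>i\<in>F. c i *\<^sub>C e i) (e j) = (if j \<in> F then c j else 0)"
proof (cases "j \<in> F")
  case True
  then show ?thesis using assms by (simp add: cinner_sum_basis orthonormal_basis_on)
next
  case False
  have "cinner (\<Sum>i\<in>F. c i *\<^sub>C e i) (e j) = (\<Sum>i\<in>F. c i * cinner (e i) (e j))"
    by (simp add: cinner.sum_left cinner_scaleC_left)
  also have "\<dots> = 0"
    using assms False by (intro sum.neutral) (auto simp: orthonormal_basis_def subset_iff)
  finally show ?thesis using False by simp
qed

section \<open>Diagonal operators described by coordinates\<close>

lemma multiplier_form:
  assumes e: "orthonormal_basis e"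
    and g: "\<And>i. i \<ge> 1 \<Longrightarrow> cinner g (e i) = complex_of_real (w i) * cinner x (e i)"
  shows "((\<lambda>i. w i * (cmod (cinner x (e i)))\<^sup>2) has_sum Re (cinner g x)) {1..}"
proof -
  have *: "((\<lambda>i. Re (cinner g (e i) * cnj (cinner x (e i)))) has_sum Re (cinner g x)) {1..}"
    by (rule has_sum_bounded_linear[OF bounded_linear_Re parseval[OF e]])
  show ?thesis
  proof (rule has_sum_cong[THEN iffD1, OF _ *])
    fix i :: nat assume "i \<in> {1..}"
    then show "Re (cinner g (e i) * cnj (cinner x (e i))) = w i * (cmod (cinner x (e i)))\<^sup>2"
      using g[of i]
      by (simp add: mult.assoc complex_norm_square[symmetric] flip: of_real_mult del: of_real_power)
  qed
qed

text \<open>Real weights make a diagonal operator symmetric. The operator enters only through the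
  coordinates of its values \<open>g\<close> and \<open>h\<close>; that such vectors exist is a
  separate matter, settled by \<open>riesz_fischer_multiplier\<close> for bounded weights.\<close>

lemma multiplier_adjoint:
  assumes e: "orthonormal_basis e"
    and g: "\<And>i. i \<ge> 1 \<Longrightarrow> cinner g (e i) = complex_of_real (w i) * cinner x (e i)"
    and h: "\<And>i. i \<ge> 1 \<Longrightarrow> cinner h (e i) = complex_of_real (w i) * cinner y (e i)"
  shows "cinner g y = cinner x h"
proof (rule has_sum_unique[OF parseval[OF e]])
  show "((\<lambda>i. cinner g (e i) * cnj (cinner y (e i))) has_sum cinner x h) {1..}"
    by (rule has_sum_cong[THEN iffD1, OF _ parseval[OF e, of x h]]) (simp add: g h)
qed

text \<open>Pythagoras turns the Cauchy criterion for the squared coefficients into one for the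
  partial sums; each coordinate of the partial sums is eventually constant.\<close>

lemma riesz_fischer:
  assumes e: "orthonormal_basis e" and c: "(\<lambda>i. (cmod (c i))\<^sup>2) summable_on {1..}"
  shows "\<exists>x. \<forall>i\<ge>1. cinner x (e i) = c i"
proof -
  \<comment> \<open>With half-open ranges the difference of two partial sums is a sum over
    \<open>{Suc m..<Suc n}\<close>, which shifts to a block of the series indexed from 0.\<close>
  define s where "s n = (\<Sum>i=1..<Suc n. c i *\<^sub>C e i)" for n
  have "Cauchy s"
  proof (rule CauchyI')
    fix \<epsilon> :: real assume "\<epsilon> > 0"
    have "summable (\<lambda>n. (cmod (c (Suc n)))\<^sup>2)"
    proof (rule summable_on_imp_summable)
      have "Suc ` UNIV = {1..}"
        by (auto simp: Suc_le_eq gr0_conv_Suc)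
      then have "(\<lambda>i. (cmod (c i))\<^sup>2) summable_on Suc ` UNIV"
        using c by simp
      then show "(\<lambda>n. (cmod (c (Suc n)))\<^sup>2) summable_on UNIV"
        by (subst (asm) summable_on_reindex) (auto simp: o_def)
    qed
    then obtain N where N: "\<And>m n. m \<ge> N \<Longrightarrow> norm (\<Sum>k=m..<n. (cmod (c (Suc k)))\<^sup>2) < \<epsilon>\<^sup>2"
      using \<open>\<epsilon> > 0\<close> unfolding summable_Cauchy by (metis zero_less_power)
    show "\<exists>M. \<forall>m\<ge>M. \<forall>n>m. dist (s m) (s n) < \<epsilon>"
    proof (intro exI allI impI)
      fix m n assume mn: "m \<ge> N" "n > m"
      have "s n = s m + (\<Sum>i=Suc m..<Suc n. c i *\<^sub>C e i)"
        unfolding s_def using mn by (intro sum.atLeastLessThan_concat[symmetric]) auto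
      then have "(dist (s m) (s n))\<^sup>2 = (norm (\<Sum>i=Suc m..<Suc n. c i *\<^sub>C e i))\<^sup>2"
        by (simp add: dist_norm)
      also have "\<dots> = (\<Sum>i=Suc m..<Suc n. (cmod (c i))\<^sup>2)"
        using e by (intro norm_sum_basis orthonormal_basis_on) auto
      also have "\<dots> = (\<Sum>k=m..<n. (cmod (c (Suc k)))\<^sup>2)"
        by (simp add: sum.shift_bounds_Suc_ivl del: sum.op_ivl_Suc)
      also have "\<dots> < \<epsilon>\<^sup>2"
        using N[OF mn(1), of n] by (simp add: sum_nonneg)
      finally show "dist (s m) (s n) < \<epsilon>"
        using \<open>\<epsilon> > 0\<close> by (simp add: power2_less_imp_less)
    qed
  qed
  then obtain x where x: "s \<longlonglongrightarrow> x"
    by (metis Cauchy_convergent_iff convergent_def)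
  have "cinner x (e i) = c i" if "i \<ge> 1" for i
  proof (rule LIMSEQ_unique)
    show "(\<lambda>n. cinner (s n) (e i)) \<longlonglongrightarrow> cinner x (e i)"
      by (intro cinner.tendsto x tendsto_const)
    have "eventually (\<lambda>n. cinner (s n) (e i) = c i) sequentially"
      using eventually_ge_at_top[of i]
    proof eventually_elim
      case (elim n)
      then show ?case unfolding s_def
        using e that by (intro cinner_sum_basis orthonormal_basis_on) auto
    qed
    then show "(\<lambda>n. cinner (s n) (e i)) \<longlonglongrightarrow> c i"
      by (simp add: tendsto_eventually)
  qed
  then show ?thesis by blast
qed

text \<open>Produces the values of resolvents and reduced resolvents of diagonal operators without
  defining them as operators.\<close>

lemma riesz_fischer_multiplier:
  assumes e: "orthonormal_basis e" and w: "\<And>i. i \<ge> 1 \<Longrightarrow> cmod (w i) \<le> C"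
  shows "\<exists>y. \<forall>i\<ge>1. cinner y (e i) = w i * cinner x (e i)"
proof (rule riesz_fischer[OF e])
  have "(\<lambda>i. C\<^sup>2 * (cmod (cinner x (e i)))\<^sup>2) summable_on {1..}"
    using parseval_norm[OF e, of x] by (intro summable_on_cmult_right) (auto simp: summable_on_def)
  then show "(\<lambda>i. (cmod (w i * cinner x (e i)))\<^sup>2) summable_on {1..}"
  proof (rule summable_on_comparison_test)
    fix i :: nat assume "i \<in> {1..}"
    then have "(cmod (w i))\<^sup>2 \<le> C\<^sup>2" using w[of i] by (intro power_mono) auto
    then show "(cmod (w i * cinner x (e i)))\<^sup>2 \<le> C\<^sup>2 * (cmod (cinner x (e i)))\<^sup>2"
      by (simp add: norm_mult power_mult_distrib mult_right_mono)
  qed auto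
qed

section \<open>Selfadjoint operators with an orthonormal basis of eigenvectors\<close>

lemma selfadjoint_onD:
  assumes "selfadjoint_on S A" "x \<in> S" "y \<in> S"
  shows "cinner (A x) y = cinner x (A y)"
proof -
  have "(y, A y) \<in> adjoint_graph S A"
    using assms by (auto simp: selfadjoint_on_def)
  then show ?thesis using assms(2) by (simp add: adjoint_graph_def)
qed

lemma selfadjoint_onI:
  assumes "selfadjoint_on S A" "\<And>x. x \<in> S \<Longrightarrow> cinner (A x) y = cinner x z"
  shows "y \<in> S" "A y = z"
proof -
  have "(y, z) \<in> adjoint_graph S A"
    using assms(2) by (simp add: adjoint_graph_def)
  then show "y \<in> S" "A y = z"
    using assms(1) by (auto simp: selfadjoint_on_def)
qed

text \<open>\<open>R\<close> is defined everywhere and can be moved to the other side: (y, z) lies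
  in the adjoint graph of the sum exactly if (y, z - R y) lies in that of \<open>A\<close>. Hence
  the domain does not change.\<close>

lemma selfadjoint_on_add_bounded:
  assumes A: "selfadjoint_on S A" and R: "selfadjoint_on UNIV R"
  shows "selfadjoint_on S (\<lambda>x. A x + R x)"
  unfolding selfadjoint_on_def
proof (intro conjI)
  show "clinear_on S (\<lambda>x. A x + R x)"
    using A R by (auto simp: selfadjoint_on_def clinear_on_def scaleC_add_right)
  show "closure S = UNIV"
    using A by (simp add: selfadjoint_on_def)
  show "adjoint_graph S (\<lambda>x. A x + R x) = {(y, A y + R y) |y. y \<in> S}"
  proof (intro set_eqI iffI)
    fix p assume "p \<in> adjoint_graph S (\<lambda>x. A x + R x)"
    then obtain y z where p: "p = (y, z)" "\<And>x. x \<in> S \<Longrightarrow> cinner (A x + R x) y = cinner x z"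
      by (auto simp: adjoint_graph_def)
    have "cinner (A x) y = cinner x (z - R y)" if "x \<in> S" for x
      using p(2)[OF that] selfadjoint_onD[OF R, of x y]
      by (simp add: cinner_add_left cinner_diff_right algebra_simps)
    from selfadjoint_onI[OF A this] show "p \<in> {(y, A y + R y) |y. y \<in> S}"
      using p(1) by auto
  next
    fix p assume "p \<in> {(y, A y + R y) |y. y \<in> S}"
    then obtain y where y: "p = (y, A y + R y)" "y \<in> S" by blast
    have "cinner (A x + R x) y = cinner x (A y + R y)" if "x \<in> S" for x
      using selfadjoint_onD[OF A that y(2)] selfadjoint_onD[OF R, of x y]
      by (simp add: cinner_add_left cinner_add_right)
    then show "p \<in> adjoint_graph S (\<lambda>x. A x + R x)"
      using y(1) by (simp add: adjoint_graph_def)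
  qed
qed

text \<open>Needed for every point of the path from \<open>D\<close> to \<open>D + R\<close>,
  including \<open>t = 0\<close>, so the proof never divides by \<open>t\<close>.\<close>

lemma selfadjoint_on_scaleR:
  assumes R: "selfadjoint_on UNIV R"
  shows "selfadjoint_on UNIV (\<lambda>x. t *\<^sub>R R x)"
  unfolding selfadjoint_on_def
proof (intro conjI)
  show "clinear_on UNIV (\<lambda>x. t *\<^sub>R R x)"
    using R by (auto simp: selfadjoint_on_def clinear_on_def scaleR_eq_scaleC
        scaleC_add_right scaleC_scaleC mult.commute)
  show "adjoint_graph UNIV (\<lambda>x. t *\<^sub>R R x) = {(y, t *\<^sub>R R y) |y. y \<in> UNIV}"
  proof (intro set_eqI iffI)
    fix p assume "p \<in> adjoint_graph UNIV (\<lambda>x. t *\<^sub>R R x)"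
    then obtain y z where p: "p = (y, z)" "\<And>x. cinner (t *\<^sub>R R x) y = cinner x z"
      by (auto simp: adjoint_graph_def)
    have "cinner x (t *\<^sub>R R y - z) = 0" for x
      using p(2)[of x] selfadjoint_onD[OF R, of x y]
      by (simp add: cinner_diff_right cinner_scaleR_left cinner_scaleR_right)
    from cinner_self_eq_norm[of "t *\<^sub>R R y - z"] this[of "t *\<^sub>R R y - z"]
    show "p \<in> {(y, t *\<^sub>R R y) |y. y \<in> UNIV}"
      using p(1) by simp
  next
    fix p assume "p \<in> {(y, t *\<^sub>R R y) |y. y \<in> UNIV}"
    then show "p \<in> adjoint_graph UNIV (\<lambda>x. t *\<^sub>R R x)"
      using selfadjoint_onD[OF R]
      by (auto simp: adjoint_graph_def cinner_scaleR_left cinner_scaleR_right)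
  qed
qed simp

text \<open>Divergence of \<open>l\<close> is what makes multiplicities finite and the spectrum
  discrete; monotonicity makes \<open>l\<close> the required numbering.\<close>

definition eigenbasis ::
    "(nat \<Rightarrow> 'a) \<Rightarrow> (nat \<Rightarrow> real) \<Rightarrow> 'a set \<Rightarrow> ('a \<Rightarrow> 'a::chilbert_space) \<Rightarrow> bool" where
  "eigenbasis f l S A \<longleftrightarrow> orthonormal_basis f \<and> (\<forall>j\<ge>1. f j \<in> S \<and> A (f j) = of_real (l j) *\<^sub>C f j) \<and>
     mono_on {1..} l \<and> filterlim l at_top sequentially"

lemma eigenbasis_coordinate:
  assumes "selfadjoint_on S A" "eigenbasis f l S A" "x \<in> S" "j \<ge> 1"
  shows "cinner (A x) (f j) = of_real (l j) * cinner x (f j)"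
  using selfadjoint_onD[OF assms(1,3), of "f j"] assms(2,4)
  by (simp add: eigenbasis_def cinner_scaleC_right)

text \<open>A selfadjoint operator has no proper symmetric extension: by Parseval (x, w) lies in the
  adjoint graph, hence in the graph. This is how membership in the domain is established from
  coordinates.\<close>

lemma eigenbasis_domainI:
  assumes A: "selfadjoint_on S A" and f: "eigenbasis f l S A"
    and w: "\<And>j. j \<ge> 1 \<Longrightarrow> cinner w (f j) = of_real (l j) * cinner x (f j)"
  shows "x \<in> S" "A x = w"
proof -
  have b: "orthonormal_basis f" using f by (simp add: eigenbasis_def)
  have "cinner (A y) x = cinner y w" if "y \<in> S" for y
  proof (rule has_sum_unique[OF parseval[OF b]])
    have "((\<lambda>i. cinner y (f i) * cnj (cinner w (f i))) has_sum cinner y w) {1..}"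
      by (rule parseval[OF b])
    then show "((\<lambda>i. cinner (A y) (f i) * cnj (cinner x (f i))) has_sum cinner y w) {1..}"
      by (rule has_sum_cong[THEN iffD1, rotated])
        (simp add: eigenbasis_coordinate[OF A f that] w)
  qed
  from selfadjoint_onI[OF A this] show "x \<in> S" "A x = w" by blast+
qed

lemma filterlim_finite_below:
  fixes l :: "nat \<Rightarrow> real"
  assumes "filterlim l at_top sequentially"
  shows "finite {n. l n \<le> c}"
proof -
  obtain N where "\<And>n. n \<ge> N \<Longrightarrow> l n > c"
    using assms unfolding filterlim_at_top_dense eventually_sequentially by blast
  then have "{n. l n \<le> c} \<subseteq> {..<N}" by (auto simp: not_less[symmetric])
  then show ?thesis by (rule finite_subset) simp
qed

text \<open>An eigenvector at \<open>z\<close> satisfies (l j - z) (x, f j) = 0, so its expansion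
  lives on the finite set of indices with \<open>l j = z\<close>.\<close>

lemma eigenspace_eq_cspan:
  assumes A: "selfadjoint_on S A" and f: "eigenbasis f l S A"
  shows "eigenspace S A z = cspan (f ` {n\<in>{1..}. complex_of_real (l n) = z})"
    and "finite {n\<in>{1..}. complex_of_real (l n) = z}"
proof -
  let ?J = "{n\<in>{1..}. complex_of_real (l n) = z}"
  have b: "orthonormal_basis f" and lim: "filterlim l at_top sequentially"
    and fS: "\<And>j. j \<ge> 1 \<Longrightarrow> f j \<in> S \<and> A (f j) = of_real (l j) *\<^sub>C f j"
    using f by (auto simp: eigenbasis_def)
  show fin: "finite ?J"
    by (rule finite_subset[OF _ filterlim_finite_below[OF lim, of "Re z"]]) auto
  have lin: "csubspace S" "\<And>x y. x \<in> S \<Longrightarrow> y \<in> S \<Longrightarrow> A (x + y) = A x + A y"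
    "\<And>c x. x \<in> S \<Longrightarrow> A (c *\<^sub>C x) = c *\<^sub>C A x"
    using A by (auto simp: selfadjoint_on_def clinear_on_def)
  show "eigenspace S A z = cspan (f ` ?J)"
  proof
    show "eigenspace S A z \<subseteq> cspan (f ` ?J)"
    proof
      fix x assume x: "x \<in> eigenspace S A z"
      then have xS: "x \<in> S" "A x = z *\<^sub>C x" by (auto simp: eigenspace_def)
      have 0: "cinner x (f j) = 0" if "j \<in> {1..} - ?J" for j
        using eigenbasis_coordinate[OF A f xS(1), of j] that
        by (auto simp: xS(2) cinner_scaleC_left)
      have "((\<lambda>i. cinner x (f i) *\<^sub>C f i) has_sum x) ?J"
        by (rule has_sum_cong_neutral[THEN iffD1, OF _ _ _ basis_expansion[OF b]])
          (use 0 in auto)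
      then have "x = (\<Sum>i\<in>?J. cinner x (f i) *\<^sub>C f i)"
        using fin has_sum_finite has_sum_unique by blast
      also have "\<dots> \<in> cspan (f ` ?J)"
        by (intro complex_vector.span_sum complex_vector.span_scale complex_vector.span_base) auto
      finally show "x \<in> cspan (f ` ?J)" .
    qed
    have "csubspace (eigenspace S A z)"
      unfolding complex_vector.subspace_def
    proof (intro conjI allI ballI)
      have S0: "0 \<in> S" using lin(1) complex_vector.subspace_0 by blast
      moreover have "A 0 = 0" using lin(2)[OF S0 S0] by simp
      ultimately show "0 \<in> eigenspace S A z" by (simp add: eigenspace_def)
      fix x assume x: "x \<in> eigenspace S A z"
      { fix y assume "y \<in> eigenspace S A z"
        with x show "x + y \<in> eigenspace S A z"
          using lin by (auto simp: eigenspace_def scaleC_add_right complex_vector.subspace_add) }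
      { fix c from x show "c *\<^sub>C x \<in> eigenspace S A z"
          using lin by (auto simp: eigenspace_def scaleC_scaleC mult.commute
              complex_vector.subspace_scale) }
    qed
    then show "cspan (f ` ?J) \<subseteq> eigenspace S A z"
      by (intro complex_vector.span_minimal) (auto simp: eigenspace_def fS)
  qed
qed

lemma orthonormal_independent:
  assumes "orthonormal_on J f" "finite J"
  shows "complex_vector.independent (f ` J)" "inj_on f J"
proof -
  show inj: "inj_on f J"
    using assms(1) unfolding inj_on_def orthonormal_on_def by (metis zero_neq_one)
  show "complex_vector.independent (f ` J)"
  proof (rule complex_vector.independent_if_scalars_zero)
    show "finite (f ` J)" using assms(2) by simp
    fix g x assume g: "(\<Sum>x\<in>f ` J. g x *\<^sub>C x) = 0" and x: "x \<in> f ` J"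
    then obtain j where j: "j \<in> J" "x = f j" by blast
    have "(\<Sum>i\<in>J. g (f i) *\<^sub>C f i) = 0"
      using g by (simp add: sum.reindex[OF inj])
    then show "g x = 0"
      using cinner_sum_basis[OF assms j(1), of "\<lambda>i. g (f i)"] j(2) by (simp add: cinner.zero_left)
  qed
qed

lemma eigenbasis_enumerates:
  assumes "selfadjoint_on S A" "eigenbasis f l S A"
  shows "enumerates_eigenvalues l S A"
  unfolding enumerates_eigenvalues_def
proof (intro conjI allI)
  show "mono_on {1..} l" using assms(2) by (simp add: eigenbasis_def)
  fix z
  let ?J = "{n\<in>{1..}. complex_of_real (l n) = z}"
  show fin: "finite ?J" by (rule eigenspace_eq_cspan(2)[OF assms])
  have "orthonormal_on ?J f"
    using assms(2) by (intro orthonormal_basis_on) (auto simp: eigenbasis_def)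
  from orthonormal_independent[OF this fin] show "card ?J = cdim (eigenspace S A z)"
    by (simp add: eigenspace_eq_cspan(1)[OF assms] complex_vector.dim_eq_card_independent card_image)
qed

text \<open>At a first disagreement with \<open>l n < l' n\<close>, monotonicity confines the
  occurrences of the value \<open>l n\<close> in \<open>l'\<close> to indices below
  \<open>n\<close>. There both lists agree, and \<open>l\<close> takes the value once more at
  \<open>n\<close>, contradicting equal multiplicities.\<close>

lemma enumerates_eigenvalues_le:
  assumes l: "enumerates_eigenvalues l S A" and l': "enumerates_eigenvalues l' S A"
    and eq: "\<And>k. 1 \<le> k \<Longrightarrow> k < n \<Longrightarrow> l k = l' k" and n: "n \<ge> 1"
  shows "l' n \<le> l n"
proof (rule ccontr)
  assume "\<not> l' n \<le> l n"
  then have less: "l n < l' n" by simp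
  let ?J = "\<lambda>l. {k\<in>{1..}. complex_of_real (l k) = complex_of_real (l n)}"
  let ?J' = "{k\<in>{1..}. complex_of_real (l' k) = complex_of_real (l n)}"
  have "card (?J l) = cdim (eigenspace S A (l n))" and fin: "finite (?J l)"
    using l unfolding enumerates_eigenvalues_def by blast+
  moreover have "card ?J' = cdim (eigenspace S A (l n))"
    using l' unfolding enumerates_eigenvalues_def by blast
  ultimately have card: "card (?J l) = card ?J'" by simp
  have "?J' \<subseteq> ?J l - {n}"
  proof
    fix k assume k: "k \<in> ?J'"
    then have lk: "l' k = l n" "k \<ge> 1" by auto
    have "k < n"
    proof (rule ccontr)
      assume "\<not> k < n"
      then have "l' n \<le> l' k"
        using l' n by (auto simp: enumerates_eigenvalues_def intro: mono_onD)
      then show False using lk less by simp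
    qed
    then show "k \<in> ?J l - {n}" using eq[of k] lk by auto
  qed
  then have "card ?J' \<le> card (?J l - {n})"
    using fin by (intro card_mono) auto
  also have "\<dots> < card (?J l)"
    using fin n by (intro card_Diff1_less) auto
  finally show False using card by simp
qed

lemma enumerates_eigenvalues_unique:
  assumes "enumerates_eigenvalues l S A" "enumerates_eigenvalues l' S A" "n \<ge> 1"
  shows "l n = l' n"
  using assms(3)
proof (induction n rule: less_induct)
  case (less n)
  then show ?case
    using enumerates_eigenvalues_le[of l S A l' n] enumerates_eigenvalues_le[of l' S A l n] assms(1,2)
    by (metis dual_order.antisym)
qed

text \<open>Any \<open>z\<close> has a positive distance from the eigenvalues different from it,
  since they tend to infinity. If \<open>z\<close> is no eigenvalue, the resolvent is the bounded
  diagonal operator with entries 1 / (l j - z); the same gap isolates every spectral point.\<close>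

lemma eigenbasis_discrete_spectrum:
  assumes A: "selfadjoint_on S A" and f: "eigenbasis f l S A"
  shows "has_discrete_spectrum S A"
proof -
  have b: "orthonormal_basis f" and lim: "filterlim l at_top sequentially"
    and fS: "\<And>j. j \<ge> 1 \<Longrightarrow> f j \<in> S \<and> A (f j) = of_real (l j) *\<^sub>C f j"
    using f by (auto simp: eigenbasis_def)
  have near: "\<exists>d>0. \<forall>j. complex_of_real (l j) \<noteq> z \<longrightarrow> d \<le> cmod (of_real (l j) - z)" for z
  proof -
    define F where "F = {n. l n \<le> Re z + 1}"
    have "finite F" unfolding F_def by (rule filterlim_finite_below[OF lim])
    \<comment> \<open>The extra 1 keeps the set nonempty and covers the indices outside
      \<open>F\<close>, whose eigenvalues exceed \<open>Re z\<close> by more than 1.\<close>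
    define d where "d = Min (insert 1 ((\<lambda>j. cmod (of_real (l j) - z)) ` {j\<in>F. complex_of_real (l j) \<noteq> z}))"
    have "d > 0" unfolding d_def using \<open>finite F\<close> by auto
    moreover have "d \<le> cmod (of_real (l j) - z)" if "complex_of_real (l j) \<noteq> z" for j
    proof (cases "j \<in> F")
      case True
      then show ?thesis unfolding d_def using \<open>finite F\<close> that by (intro Min_le) auto
    next
      case False
      then have "1 \<le> \<bar>Re (of_real (l j) - z)\<bar>" by (auto simp: F_def)
      also have "\<dots> \<le> cmod (of_real (l j) - z)" by (rule abs_Re_le_cmod)
      finally show ?thesis unfolding d_def using \<open>finite F\<close> by (intro Min.coboundedI[THEN order.trans]) auto
    qed
    ultimately show ?thesis by blast
  qed
  have sub: "spectrum S A \<subseteq> (\<lambda>j. complex_of_real (l j)) ` {1..}"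
  proof (rule ccontr)
    assume "\<not> ?thesis"
    then obtain z where z: "z \<in> spectrum S A" "\<And>j. j \<ge> 1 \<Longrightarrow> complex_of_real (l j) \<noteq> z"
      by force
    obtain d where d: "d > 0" "\<And>j. j \<ge> 1 \<Longrightarrow> d \<le> cmod (of_real (l j) - z)"
      using near[of z] z(2) by blast
    have coord: "cinner (A x - z *\<^sub>C x) (f j) = (of_real (l j) - z) * cinner x (f j)"
      if "x \<in> S" "j \<ge> 1" for x j
      using eigenbasis_coordinate[OF A f that]
      by (simp add: cinner_diff_left cinner_scaleC_left left_diff_distrib)
    have bound: "norm x \<le> (1 / d) * norm (A x - z *\<^sub>C x)" if "x \<in> S" for x
    proof (rule norm_le_coordinates[OF b])
      show "0 \<le> 1 / d" using d(1) by simp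
      fix i :: nat assume i: "i \<ge> 1"
      have "d * cmod (cinner x (f i)) \<le> cmod (cinner (A x - z *\<^sub>C x) (f i))"
        using d(2)[OF i] by (simp add: coord[OF that i] norm_mult mult_right_mono)
      then show "cmod (cinner x (f i)) \<le> 1 / d * cmod (cinner (A x - z *\<^sub>C x) (f i))"
        using d(1) by (simp add: field_simps)
    qed
    have "bij_betw (\<lambda>x. A x - z *\<^sub>C x) S UNIV"
      unfolding bij_betw_def
    proof
      show "inj_on (\<lambda>x. A x - z *\<^sub>C x) S"
      proof (rule inj_onI, rule basis_eqI[OF b])
        fix x y and i :: nat assume xy: "x \<in> S" "y \<in> S" "A x - z *\<^sub>C x = A y - z *\<^sub>C y" and i: "1 \<le> i"
        have "(of_real (l i) - z) * cinner x (f i) = (of_real (l i) - z) * cinner y (f i)"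
          unfolding coord[OF xy(1) i, symmetric] coord[OF xy(2) i, symmetric] xy(3) ..
        moreover have "of_real (l i) - z \<noteq> 0" using z(2)[OF i] by simp
        ultimately show "cinner x (f i) = cinner y (f i)" using mult_left_cancel by blast
      qed
      show "(\<lambda>x. A x - z *\<^sub>C x) ` S = UNIV"
      proof (intro set_eqI iffI UNIV_I)
        fix y
        have "\<exists>x. \<forall>i\<ge>1. cinner x (f i) = 1 / (of_real (l i) - z) * cinner y (f i)"
        proof (rule riesz_fischer_multiplier[OF b, where C = "1 / d"])
          fix i :: nat assume "1 \<le> i"
          then show "cmod (1 / (complex_of_real (l i) - z)) \<le> 1 / d"
            using d by (auto simp: norm_divide intro!: divide_left_mono mult_pos_pos z(2)
                intro: less_le_trans)
        qed
        then obtain x where x: "\<And>i. i \<ge> 1 \<Longrightarrow> cinner x (f i) = 1 / (of_real (l i) - z) * cinner y (f i)"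
          by blast
        \<comment> \<open>This is \<open>A x = y + z x\<close> in coordinates; the maximality of the
          domain then puts \<open>x\<close> into \<open>S\<close>.\<close>
        have "cinner (y + z *\<^sub>C x) (f j) = of_real (l j) * cinner x (f j)" if "j \<ge> 1" for j
          using z(2)[OF that]
          by (simp add: x[OF that] cinner_add_left cinner_scaleC_left divide_simps) (simp add: algebra_simps)
        from eigenbasis_domainI[OF A f this] show "y \<in> (\<lambda>x. A x - z *\<^sub>C x) ` S"
          by (intro image_eqI[of _ _ x]) auto
      qed
    qed
    then have "z \<in> resolvent_set S A"
      unfolding resolvent_set_def using bound by blast
    then show False using z(1) by (simp add: spectrum_def)
  qed
  show ?thesis
    unfolding has_discrete_spectrum_def
  proof (intro ballI conjI)
    fix z assume z: "z \<in> spectrum S A"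
    obtain d where d: "d > 0" "\<And>j. complex_of_real (l j) \<noteq> z \<Longrightarrow> d \<le> cmod (of_real (l j) - z)"
      using near[of z] by blast
    have "y = z" if y: "y \<in> spectrum S A" "dist z y < d" for y
    proof (rule ccontr)
      assume "y \<noteq> z"
      moreover obtain j where "y = complex_of_real (l j)" using y(1) sub by blast
      ultimately show False using d(2)[of j] y(2) by (simp add: dist_norm norm_minus_commute)
    qed
    then show "z isolated_in spectrum S A"
      using z d(1) by (auto simp: isolated_in_dist_Ex_iff)
    obtain j where j: "j \<ge> 1" "z = complex_of_real (l j)" using z sub by auto
    then have "f j \<in> eigenspace S A z" using fS by (simp add: eigenspace_def)
    moreover have "norm (f j) = 1"
      using orthonormal_norm[OF orthonormal_basis_on[OF b order_refl]] j(1) by simp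
    ultimately show "eigenspace S A z \<noteq> {0}"
      by (metis norm_zero singletonD zero_neq_one)
    show "\<exists>B. finite B \<and> eigenspace S A z \<subseteq> cspan B"
      unfolding eigenspace_eq_cspan(1)[OF A f]
      using finite_imageI[OF eigenspace_eq_cspan(2)[OF A f]] by blast
  qed
qed

section \<open>The spectral theorem for positive compact operators\<close>

text \<open>Gaussian elimination by induction on the equations: equation \<open>k\<close> either is
  trivial or has a pivot \<open>p\<close>, and then one equation and one unknown disappear
  together.\<close>

lemma underdetermined_system:
  fixes a :: "'i \<Rightarrow> 'j \<Rightarrow> complex"
  assumes "finite I" "finite J" "card I < card J"
  shows "\<exists>c. (\<exists>j\<in>J. c j \<noteq> 0) \<and> (\<forall>i\<in>I. (\<Sum>j\<in>J. a i j * c j) = 0)"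
  using assms
proof (induction I arbitrary: J a rule: finite_induct)
  case empty
  then have "J \<noteq> {}" by auto
  then show ?case by (intro exI[of _ "\<lambda>_. 1"]) auto
next
  case (insert k I)
  show ?case
  proof (cases "\<forall>j\<in>J. a k j = 0")
    case True
    have "card I < card J" using insert by simp
    from insert.IH[OF insert.prems(1) this, of a] True show ?thesis by auto
  next
    case False
    then obtain p where p: "p \<in> J" "a k p \<noteq> 0" by blast
    \<comment> \<open>The rows after elimination of the unknown \<open>p\<close> by means of row
      \<open>k\<close>.\<close>
    define a' where "a' i j = a i j - a i p * a k j / a k p" for i j
    have "card I < card (J - {p})" using insert p by auto
    then obtain c where c: "\<exists>j\<in>J - {p}. c j \<noteq> 0" "\<forall>i\<in>I. (\<Sum>j\<in>J - {p}. a' i j * c j) = 0"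
      using insert.IH[of "J - {p}" a'] insert.prems(1) by auto
    \<comment> \<open>The value that row \<open>k\<close> forces on the unknown
      \<open>p\<close>.\<close>
    define cp where "cp = - (\<Sum>j\<in>J - {p}. a k j * c j) / a k p"
    define c' where "c' = c(p := cp)"
    have sum_c': "(\<Sum>j\<in>J. a i j * c' j) = a i p * cp + (\<Sum>j\<in>J - {p}. a i j * c j)" for i
    proof -
      have "(\<Sum>j\<in>J - {p}. a i j * c' j) = (\<Sum>j\<in>J - {p}. a i j * c j)"
        by (intro sum.cong) (auto simp: c'_def)
      then show ?thesis
        using insert.prems(1) p by (simp add: sum.remove[of J p] c'_def)
    qed
    have "(\<Sum>j\<in>J. a i j * c' j) = 0" if "i \<in> insert k I" for i
    proof (cases "i = k")
      case True
      then show ?thesis using p by (simp add: sum_c' cp_def)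
    next
      case False
      then have "(\<Sum>j\<in>J - {p}. a' i j * c j) = 0" using c that by simp
      moreover have "(\<Sum>j\<in>J - {p}. a' i j * c j)
          = (\<Sum>j\<in>J - {p}. a i j * c j) - a i p / a k p * (\<Sum>j\<in>J - {p}. a k j * c j)"
        unfolding sum_distrib_left sum_subtractf[symmetric]
        by (intro sum.cong) (auto simp: a'_def algebra_simps)
      ultimately show ?thesis by (simp add: sum_c' cp_def)
    qed
    moreover have "\<exists>j\<in>J. c' j \<noteq> 0" using c(1) by (auto simp: c'_def)
    ultimately show ?thesis by (intro exI[of _ c'] conjI ballI)
  qed
qed

text \<open>Orthogonality to \<open>X\<close> is a homogeneous system of \<open>card X\<close>
  equations in \<open>card J\<close> coefficients. It is used twice: to continue the construction of
  eigenvectors and to find the test vector of a min-max argument.\<close>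

lemma exists_orthogonal_vector:
  assumes e: "orthonormal_on J e" "finite J" and X: "finite X" "card X < card J"
  shows "\<exists>x \<in> cspan (e ` J). norm x = 1 \<and> (\<forall>y\<in>X. cinner x y = 0)"
proof -
  obtain c where c: "\<exists>j\<in>J. c j \<noteq> 0" "\<forall>y\<in>X. (\<Sum>j\<in>J. cinner (e j) y * c j) = 0"
    using underdetermined_system[OF X(1) e(2) X(2), of "\<lambda>y j. cinner (e j) y"] by blast
  define x where "x = (\<Sum>j\<in>J. c j *\<^sub>C e j)"
  have "x \<noteq> 0"
  proof
    assume "x = 0"
    obtain j where j: "j \<in> J" "c j \<noteq> 0" using c(1) by blast
    then show False
      using cinner_sum_basis[OF e j(1), of c] \<open>x = 0\<close> by (simp add: x_def cinner.zero_left)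
  qed
  have x_span: "x \<in> cspan (e ` J)"
    unfolding x_def
    by (intro complex_vector.span_sum complex_vector.span_scale complex_vector.span_base) auto
  have "cinner x y = 0" if "y \<in> X" for y
    using c(2) that by (simp add: x_def cinner.sum_left cinner_scaleC_left mult.commute)
  then show ?thesis
    using \<open>x \<noteq> 0\<close> x_span
    by (intro bexI[of _ "complex_of_real (1 / norm x) *\<^sub>C x"])
      (auto simp: norm_scaleC cinner_scaleC_left norm_divide intro: complex_vector.span_scale)
qed

text \<open>Tailored to the inverse of \<open>D + R + c\<close>. Injectivity makes the eigenvalues
  strictly positive, hence invertible; the dense range makes the eigenvectors complete.\<close>

locale positive_compact =
  fixes B :: "'a \<Rightarrow> 'a::chilbert_space"
  assumes add: "B (x + y) = B x + B y"
    and scale: "B (c *\<^sub>C x) = c *\<^sub>C B x"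
    and norm_bound: "\<exists>C. \<forall>x. norm (B x) \<le> C * norm x"
    and symmetric: "cinner (B x) y = cinner x (B y)"
    and nonneg: "0 \<le> Re (cinner (B x) x)"
    and injective: "B x = 0 \<Longrightarrow> x = 0"
    and compact: "(\<And>n::nat. norm (u n) \<le> 1) \<Longrightarrow> \<exists>r z. strict_mono r \<and> (\<lambda>n. B (u (r n))) \<longlonglongrightarrow> z"
    and dense: "closure (range B) = UNIV"
begin

lemma minus: "B (x - y) = B x - B y"
  using add[of "x - y" y] by simp

lemma bounded_linear: "bounded_linear B"
proof -
  obtain C where "\<And>x. norm (B x) \<le> C * norm x" using norm_bound by blast
  then show ?thesis
    by (intro bounded_linear_intro[of _ C]) (auto simp: add scale scaleR_eq_scaleC mult.commute)
qed

text \<open>Along unit vectors y_n that maximize the norm of B y_n, the vectors B^2 y_n - M^2 y_n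
  tend to 0. Compactness makes B y_n, hence B^2 y_n, converge along a subsequence, and since M > 0
  the y_n themselves converge, to an eigenvector of B^2.\<close>

lemma top_eigenvector:
  assumes V: "csubspace V" "closed V" "\<And>x. x \<in> V \<Longrightarrow> B x \<in> V" and x0: "x0 \<in> V" "x0 \<noteq> 0"
  shows "\<exists>f \<beta>. f \<in> V \<and> norm f = 1 \<and> \<beta> > 0 \<and> B f = complex_of_real \<beta> *\<^sub>C f
    \<and> (\<forall>x\<in>V. norm (B x) \<le> \<beta> * norm x)"
proof -
  define U where "U = {x\<in>V. norm x = 1}"
  define M where "M = (SUP x\<in>U. norm (B x))"
  obtain C where C: "\<And>x. norm (B x) \<le> C * norm x" using norm_bound by blast
  have unit: "complex_of_real (1 / norm x) *\<^sub>C x \<in> U" if "x \<in> V" "x \<noteq> 0" for x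
    using that V(1) by (auto simp: U_def norm_scaleC norm_divide complex_vector.subspace_scale)
  have bdd: "bdd_above ((\<lambda>x. norm (B x)) ` U)"
    using C by (intro bdd_aboveI2[of _ _ C]) (metis (mono_tags, lifting) U_def mem_Collect_eq mult.right_neutral)
  have le_M: "norm (B x) \<le> M * norm x" if "x \<in> V" for x
  proof (cases "x = 0")
    case True
    then show ?thesis using C[of x] by simp
  next
    case False
    have "norm (B (complex_of_real (1 / norm x) *\<^sub>C x)) \<le> M"
      unfolding M_def by (intro cSUP_upper bdd unit that False)
    then show ?thesis using False by (simp add: scale norm_scaleC norm_divide field_simps)
  qed
  have "0 < norm (B x0)" using injective x0 by auto
  also have "\<dots> \<le> M * norm x0" by (rule le_M[OF x0(1)])
  finally have "M > 0" using x0 by (simp add: zero_less_mult_iff)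
  have "\<exists>x\<in>U. M - inverse (real (Suc n)) < norm (B x)" for n
    using unit[OF x0] bdd by (subst less_cSUP_iff[symmetric]) (auto simp: M_def[symmetric])
  then obtain y where y: "\<And>n. y n \<in> U" "\<And>n. M - inverse (real (Suc n)) < norm (B (y n))"
    by metis
  then have yV: "\<And>n. y n \<in> V" "\<And>n. norm (y n) = 1" by (auto simp: U_def)
  have "(\<lambda>n. norm (B (y n))) \<longlonglongrightarrow> M"
  proof (rule tendsto_sandwich)
    show "(\<lambda>n. M - inverse (real (Suc n))) \<longlonglongrightarrow> M"
      using tendsto_diff[OF tendsto_const LIMSEQ_inverse_real_of_nat] by simp
    show "\<forall>\<^sub>F n in sequentially. M - inverse (real (Suc n)) \<le> norm (B (y n))"
      using y(2) by (simp add: less_imp_le)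
    show "\<forall>\<^sub>F n in sequentially. norm (B (y n)) \<le> M"
      using le_M[OF yV(1)] yV(2) by simp
  qed simp
  moreover obtain r z where r: "strict_mono r" "(\<lambda>n. B (y (r n))) \<longlonglongrightarrow> z"
    using compact[of y] yV(2) by auto
  ultimately have lim_norm: "(\<lambda>n. norm (B (y (r n)))) \<longlonglongrightarrow> M"
    using LIMSEQ_subseq_LIMSEQ[of _ M r] by (simp add: o_def)
  have BB: "(\<lambda>n. B (B (y (r n)))) \<longlonglongrightarrow> B z"
    by (rule bounded_linear.tendsto[OF bounded_linear r(2)])
  \<comment> \<open>Expand the square: by symmetry the cross term is M^2 times the squared norm of B
    y_n, and both outer terms are at most M^4.\<close>
  have diff: "(norm (B (B (y n)) - complex_of_real (M\<^sup>2) *\<^sub>C y n))\<^sup>2 \<le> 2 * M ^ 4 - 2 * M\<^sup>2 * (norm (B (y n)))\<^sup>2" for n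
  proof -
    have "norm (B (B (y n))) \<le> M * norm (B (y n))"
      by (rule le_M[OF V(3)[OF yV(1)]])
    also have "\<dots> \<le> M * M"
      using le_M[OF yV(1), of n] \<open>M > 0\<close> yV(2) by (intro mult_left_mono) auto
    finally have "(norm (B (B (y n))))\<^sup>2 \<le> (M * M)\<^sup>2" by (intro power_mono) auto
    moreover have "Re (cinner (B (B (y n))) (complex_of_real (M\<^sup>2) *\<^sub>C y n)) = M\<^sup>2 * (norm (B (y n)))\<^sup>2"
      using symmetric[of "B (y n)" "y n"]
      by (simp add: cinner_scaleC_right cinner_self del: of_real_power)
    moreover have "norm (complex_of_real (M\<^sup>2) *\<^sub>C y n) = M * M"
      using yV(2) by (simp add: norm_scaleC norm_power power2_eq_square norm_mult)
    ultimately show ?thesis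
      unfolding norm_diff_square by (simp add: power2_eq_square power4_eq_xxxx algebra_simps)
  qed
  have "(\<lambda>n. (norm (B (B (y (r n))) - complex_of_real (M\<^sup>2) *\<^sub>C y (r n)))\<^sup>2) \<longlonglongrightarrow> 0"
  proof (rule tendsto_sandwich[OF _ _ tendsto_const])
    have "(\<lambda>n. 2 * M ^ 4 - 2 * M\<^sup>2 * (norm (B (y (r n))))\<^sup>2) \<longlonglongrightarrow> 2 * M ^ 4 - 2 * M\<^sup>2 * M\<^sup>2"
      by (intro tendsto_intros lim_norm)
    then show "(\<lambda>n. 2 * M ^ 4 - 2 * M\<^sup>2 * (norm (B (y (r n))))\<^sup>2) \<longlonglongrightarrow> 0"
      by (simp add: power2_eq_square power4_eq_xxxx)
  qed (use diff in auto)
  then have "(\<lambda>n. norm (B (B (y (r n))) - complex_of_real (M\<^sup>2) *\<^sub>C y (r n))) \<longlonglongrightarrow> 0"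
    using tendsto_real_sqrt[of _ 0] by (fastforce simp: real_sqrt_abs)
  then have "(\<lambda>n. B (B (y (r n))) - complex_of_real (M\<^sup>2) *\<^sub>C y (r n)) \<longlonglongrightarrow> 0"
    by (simp add: tendsto_norm_zero_iff)
  from tendsto_diff[OF BB this] have "(\<lambda>n. complex_of_real (M\<^sup>2) *\<^sub>C y (r n)) \<longlonglongrightarrow> B z"
    by simp
  from scaleC.tendsto[OF tendsto_const[of "complex_of_real (1 / M\<^sup>2)"] this]
  have lim: "(\<lambda>n. y (r n)) \<longlonglongrightarrow> complex_of_real (1 / M\<^sup>2) *\<^sub>C B z"
    using \<open>M > 0\<close> by (simp add: scaleC_scaleC)
  define x where "x = complex_of_real (1 / M\<^sup>2) *\<^sub>C B z"
  have xV: "x \<in> V"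
    using closed_sequentially[OF V(2), of "\<lambda>n. y (r n)"] yV(1) lim by (simp add: x_def)
  have "(\<lambda>n. norm (y (r n))) \<longlonglongrightarrow> norm x"
    using lim unfolding x_def by (rule tendsto_norm)
  then have norm_x: "norm x = 1"
    using yV(2) by (simp add: LIMSEQ_const_iff)
  have "(\<lambda>n. B (B (y (r n)))) \<longlonglongrightarrow> B (B x)"
    using lim unfolding x_def by (intro bounded_linear.tendsto[OF bounded_linear])
  then have "B (B x) = B z" using BB LIMSEQ_unique by blast
  then have BBx: "B (B x) = complex_of_real (M\<^sup>2) *\<^sub>C x"
    using \<open>M > 0\<close> by (simp add: x_def scaleC_scaleC)
  \<comment> \<open>\<open>B\<^sup>2 - M\<^sup>2 = (B - M)(B + M)\<close>, and \<open>- M\<close> is not an eigenvalue of a positive operator.\<close>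
  define w where "w = B x + complex_of_real M *\<^sub>C x"
  have wV: "w \<in> V"
    using V xV by (simp add: w_def complex_vector.subspace_add complex_vector.subspace_scale)
  have "w \<noteq> 0"
  proof
    assume "w = 0"
    then have "cinner (B x) x + complex_of_real M * cinner x x = 0"
      using cinner.zero_left[of x] unfolding w_def
      by (metis cinner_add_left cinner_scaleC_left)
    from arg_cong[OF this, of Re] show False
      using nonneg[of x] \<open>M > 0\<close> norm_x by (simp add: cinner_self)
  qed
  have Bw: "B w = complex_of_real M *\<^sub>C w"
    by (simp add: w_def add scale BBx scaleC_add_right scaleC_scaleC power2_eq_square add.commute)
  show ?thesis
  proof (intro exI conjI ballI)
    let ?f = "complex_of_real (1 / norm w) *\<^sub>C w"
    show "?f \<in> V" "norm ?f = 1"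
      using unit[OF wV \<open>w \<noteq> 0\<close>] by (auto simp: U_def)
    show "B ?f = complex_of_real M *\<^sub>C ?f"
      by (simp add: scale Bw scaleC_scaleC mult.commute)
  qed (use \<open>M > 0\<close> le_M in auto)
qed

text \<open>Repeatedly take a top eigenvector on the orthogonal complement of those already found.
  On that complement \<open>B\<close> is bounded by the current eigenvalue, which gives the
  ordering, and, as the eigenvalues tend to 0, shows that the range of \<open>B\<close> lies in the
  closed span.\<close>

lemma spectral:
  fixes e :: "nat \<Rightarrow> 'a"
  assumes e: "orthonormal_basis e"
  shows "\<exists>f \<beta>. orthonormal_basis f \<and> (\<forall>j\<ge>1. \<beta> j > 0 \<and> B (f j) = complex_of_real (\<beta> j) *\<^sub>C f j) \<and>
    (\<forall>i\<ge>1. \<forall>j\<ge>i. \<beta> j \<le> \<beta> i) \<and> \<beta> \<longlonglongrightarrow> 0"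
proof -
  define V where "V X = {x. \<forall>y\<in>X. cinner x y = 0}" for X :: "'a set"
  define Q where "Q X f \<beta> \<longleftrightarrow> f \<in> V X \<and> norm f = 1 \<and> \<beta> > 0 \<and> B f = complex_of_real \<beta> *\<^sub>C f
    \<and> (\<forall>x\<in>V X. norm (B x) \<le> \<beta> * norm x)" for X f \<beta>
  \<comment> \<open>The choice depends only on the set of vectors found so far, so the recursion can
    run over these sets.\<close>
  define pick where "pick X = (SOME f. \<exists>\<beta>. Q X f \<beta>)" for X
  define X where "X = rec_nat {} (\<lambda>_ X. insert (pick X) X)"
  define g where "g n = pick (X n)" for n
  have X_Suc: "X 0 = {}" "X (Suc n) = insert (g n) (X n)" for n by (auto simp: X_def g_def)
  have pick: "\<exists>\<beta>. Q Y (pick Y) \<beta>" if Y: "finite Y" "\<And>y. y \<in> Y \<Longrightarrow> \<exists>b. B y = complex_of_real b *\<^sub>C y" for Y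
  proof -
    \<comment> \<open>One basis vector more than \<open>card Y\<close> ensures that the complement
      of \<open>Y\<close> is nonzero, so the construction never stops.\<close>
    have "\<exists>x \<in> cspan (e ` {1..Suc (card Y)}). norm x = 1 \<and> (\<forall>y\<in>Y. cinner x y = 0)"
      using e Y(1) by (intro exists_orthogonal_vector orthonormal_basis_on) auto
    then obtain x where "x \<in> V Y" "norm x = 1" by (auto simp: V_def)
    then have x: "x \<in> V Y" "x \<noteq> 0" by auto
    have "csubspace (V Y)"
      by (auto simp: complex_vector.subspace_def V_def cinner.zero_left cinner_add_left cinner_scaleC_left)
    moreover have "closed (V Y)"
    proof -
      have "V Y = (\<Inter>y\<in>Y. {x. cinner x y = 0})" by (auto simp: V_def)
      moreover have "closed {x. cinner x y = 0}" for y :: 'a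
        by (intro closed_Collect_eq continuous_intros cinner.continuous_on)
      ultimately show ?thesis by auto
    qed
    moreover have "B x \<in> V Y" if "x \<in> V Y" for x
      unfolding V_def
    proof (intro CollectI ballI)
      fix y assume "y \<in> Y"
      then obtain b where "B y = complex_of_real b *\<^sub>C y" using Y(2) by blast
      then show "cinner (B x) y = 0"
        using that \<open>y \<in> Y\<close> by (simp add: symmetric cinner_scaleC_right V_def)
    qed
    ultimately have "\<exists>f \<beta>. Q Y f \<beta>" unfolding Q_def using x by (intro top_eigenvector)
    then show ?thesis unfolding pick_def by (rule someI_ex)
  qed
  have X_inv: "finite (X n) \<and> (\<forall>y\<in>X n. \<exists>b. B y = complex_of_real b *\<^sub>C y)" for n
  proof (induction n)
    case (Suc n)
    then show ?case using pick[of "X n"] by (auto simp: X_Suc g_def Q_def)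
  qed (simp add: X_Suc)
  then have "\<forall>n. \<exists>\<beta>. Q (X n) (g n) \<beta>"
    using pick by (simp add: g_def)
  then obtain \<beta> where Q: "\<And>n. Q (X n) (g n) (\<beta> n)" by metis
  have X_eq: "X n = g ` {..<n}" for n
    by (induction n) (auto simp: X_Suc lessThan_Suc)
  have orth: "cinner (g i) (g j) = (if i = j then 1 else 0)" for i j
  proof -
    have *: "cinner (g j) (g i) = 0" if "i < j" for i j
      using Q[of j] that by (auto simp: Q_def V_def X_eq)
    have "cinner (g i) (g i) = 1"
      using Q[of i] by (simp add: Q_def cinner_self)
    then show ?thesis
      using *[of i j] *[of j i] cinner_commute[of "g i" "g j"] by (cases i j rule: linorder_cases) auto
  qed
  have eig: "B (g n) = complex_of_real (\<beta> n) *\<^sub>C g n" "\<beta> n > 0" "norm (g n) = 1" for n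
    using Q[of n] by (auto simp: Q_def)
  have le: "norm (B x) \<le> \<beta> n * norm x" if "\<And>i. i < n \<Longrightarrow> cinner x (g i) = 0" for x n
    using Q[of n] that by (auto simp: Q_def V_def X_eq)
  have decr: "\<beta> j \<le> \<beta> i" if "i \<le> j" for i j
    using le[of i "g j"] that eig[of j] by (simp add: orth norm_scaleC)
  \<comment> \<open>Otherwise the images of the orthonormal \<open>g n\<close> would keep a mutual
    distance of at least \<epsilon>, and no subsequence could converge.\<close>
  have small: "\<exists>n. \<beta> n < \<epsilon>" if \<epsilon>: "\<epsilon> > 0" for \<epsilon>
  proof (rule ccontr)
    assume "\<not> ?thesis"
    then have ge: "\<epsilon> \<le> \<beta> n" for n by (auto simp: not_less)
    obtain r z where r: "strict_mono r" "(\<lambda>n. B (g (r n))) \<longlonglongrightarrow> z"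
      using compact[of g] eig(3) by auto
    then obtain N where N: "\<And>m n. m \<ge> N \<Longrightarrow> n \<ge> N \<Longrightarrow> dist (B (g (r m))) (B (g (r n))) < \<epsilon>"
      using metric_CauchyD[OF LIMSEQ_imp_Cauchy[OF r(2)] \<epsilon>] by blast
    have "r N \<noteq> r (Suc N)" using r(1) by (simp add: strict_mono_eq)
    then have "(dist (B (g (r N))) (B (g (r (Suc N)))))\<^sup>2 = (\<beta> (r N))\<^sup>2 + (\<beta> (r (Suc N)))\<^sup>2"
      by (simp add: dist_norm norm_diff_square eig norm_scaleC cinner_scaleC_left cinner_scaleC_right orth)
    moreover have "\<epsilon>\<^sup>2 \<le> (\<beta> (r N))\<^sup>2" using ge \<epsilon> by (intro power_mono) auto
    moreover have "(dist (B (g (r N))) (B (g (r (Suc N)))))\<^sup>2 < \<epsilon>\<^sup>2"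
      using N[of N "Suc N"] by (intro power_strict_mono) auto
    ultimately show False using zero_le_power2[of "\<beta> (r (Suc N))"] by linarith
  qed
  have on: "orthonormal_on F g" for F using orth by (auto simp: orthonormal_on_def)
  have "range B \<subseteq> closure (cspan (range g))"
  proof
    fix z assume "z \<in> range B"
    then obtain y where y: "z = B y" by blast
    show "z \<in> closure (cspan (range g))"
      unfolding closure_approachable
    proof (intro allI impI)
      fix \<epsilon> :: real assume "\<epsilon> > 0"
      then obtain n where n: "\<beta> n < \<epsilon> / (norm y + 1)"
        using small[of "\<epsilon> / (norm y + 1)"] by (auto simp: add_nonneg_pos)
      \<comment> \<open>The residual \<open>y - p\<close> is orthogonal to the first
        \<open>n\<close> eigenvectors, where \<open>B\<close> is bounded by
        \<open>\<beta> n\<close>.\<close>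
      define p where "p = (\<Sum>i<n. cinner y (g i) *\<^sub>C g i)"
      have "B p = (\<Sum>i<n. cinner y (g i) *\<^sub>C B (g i))"
        unfolding p_def by (simp add: bounded_linear.linear[OF bounded_linear] linear_sum scale)
      also have "\<dots> \<in> cspan (range g)"
        unfolding eig
        by (intro complex_vector.span_sum complex_vector.span_scale complex_vector.span_base) auto
      finally have "B p \<in> cspan (range g)" .
      moreover have "dist (B p) z < \<epsilon>"
      proof -
        have "dist (B p) z = norm (B (y - p))"
          by (simp add: y minus dist_norm norm_minus_commute)
        also have "\<dots> \<le> \<beta> n * norm (y - p)"
          unfolding p_def
          by (intro le) (simp add: cinner_diff_left cinner_sum_basis[OF on, of "{..<n}"])
        also have "\<dots> \<le> \<beta> n * norm y"
          unfolding p_def using eig(2)[of n] by (intro mult_left_mono norm_diff_projection_le on) auto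
        also have "\<dots> \<le> \<beta> n * (norm y + 1)"
          using eig(2)[of n] by simp
        also have "\<dots> < \<epsilon>"
          using n by (simp add: pos_less_divide_eq add_nonneg_pos)
        finally show ?thesis .
      qed
      ultimately show "\<exists>s\<in>cspan (range g). dist s z < \<epsilon>" by blast
    qed
  qed
  then have "closure (range B) \<subseteq> closure (cspan (range g))"
    by (rule closure_minimal) simp
  then have span: "closure (cspan (range g)) = UNIV" using dense by auto
  \<comment> \<open>The construction counts from 0, bases count from 1.\<close>
  have "(\<lambda>n. g (n - 1)) ` {1..} = range g"
  proof (intro set_eqI iffI)
    fix y assume "y \<in> range g"
    then obtain n where "y = g n" by blast
    then show "y \<in> (\<lambda>n. g (n - 1)) ` {1..}" by (intro image_eqI[of _ _ "Suc n"]) auto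
  qed auto
  then have "orthonormal_basis (\<lambda>n. g (n - 1))"
    using span orth by (auto simp: orthonormal_basis_def)
  moreover have "(\<lambda>n. \<beta> (n - 1)) \<longlonglongrightarrow> 0"
    unfolding LIMSEQ_iff
  proof (intro allI impI)
    fix \<epsilon> :: real assume "\<epsilon> > 0"
    then obtain N where N: "\<beta> N < \<epsilon>" using small by blast
    have "norm (\<beta> (n - 1) - 0) < \<epsilon>" if "n \<ge> Suc N" for n
    proof -
      have "N \<le> n - 1" using that by simp
      from decr[OF this] show ?thesis using eig(2)[of "n - 1"] N by simp
    qed
    then show "\<exists>no. \<forall>n\<ge>no. norm (\<beta> (n - 1) - 0) < \<epsilon>" by blast
  qed
  ultimately show ?thesis
    using eig decr by (intro exI[of _ "\<lambda>n. g (n - 1)"] exI[of _ "\<lambda>n. \<beta> (n - 1)"]) auto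
qed

end

section \<open>Bounded perturbations of the number operator\<close>

lemma eigenbasis_form:
  assumes A: "selfadjoint_on S A" and f: "eigenbasis f l S A" and x: "x \<in> S"
  shows "((\<lambda>j. l j * (cmod (cinner x (f j)))\<^sup>2) has_sum Re (cinner (A x) x)) {1..}"
proof -
  have b: "orthonormal_basis f" using f by (simp add: eigenbasis_def)
  show ?thesis
    by (rule multiplier_form[OF b eigenbasis_coordinate[OF A f x]])
qed

text \<open>Min-max with one test vector: a unit \<open>x\<close> in the span of
  \<open>f 1, ..., f n\<close> that is orthogonal to \<open>f' 1, ..., f' (n - 1)\<close> has (A x,
  x) at most \<open>l n\<close> and (A' x, x) at least \<open>l' n\<close>.\<close>

lemma eigenvalue_perturbation:
  assumes A: "selfadjoint_on S A" "eigenbasis f l S A"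
    and A': "selfadjoint_on S A'" "eigenbasis f' l' S A'"
    and q: "\<And>x. x \<in> S \<Longrightarrow> norm (A' x - A x) \<le> q * norm x" and n: "n \<ge> 1"
  shows "l' n \<le> l n + q"
proof -
  have b: "orthonormal_basis f" and b': "orthonormal_basis f'" and fS: "\<And>j. j \<ge> 1 \<Longrightarrow> f j \<in> S"
    and mono: "mono_on {1..} l" "mono_on {1..} l'"
    using A A' by (auto simp: eigenbasis_def)
  have on: "orthonormal_on {1..n} f" using b by (rule orthonormal_basis_on) auto
  \<comment> \<open>At most n - 1 conditions on an n-dimensional space.\<close>
  have "card (f' ` {1..<n}) < card {1..n}"
    using card_image_le[of "{1..<n}" f'] n by auto
  then obtain x where x: "x \<in> cspan (f ` {1..n})" "norm x = 1" "\<And>i. i \<in> {1..<n} \<Longrightarrow> cinner x (f' i) = 0"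
    using exists_orthogonal_vector[OF on, of "f' ` {1..<n}"] by auto
  have "cspan (f ` {1..n}) \<subseteq> S"
    using A(1) fS by (intro complex_vector.span_minimal) (auto simp: selfadjoint_on_def clinear_on_def)
  then have xS: "x \<in> S" using x(1) by blast
  have 0: "cinner x (f j) = 0" if "j > n" for j
  proof -
    have "x = (\<Sum>i=1..n. cinner x (f i) *\<^sub>C f i)"
      using x(1) on by (intro cspan_image_eq) auto
    then have "cinner x (f j) = cinner (\<Sum>i=1..n. cinner x (f i) *\<^sub>C f i) (f j)"
      by (rule arg_cong)
    also have "\<dots> = 0"
      using that by (subst cinner_partial_sum[OF b]) auto
    finally show ?thesis .
  qed
  have "Re (cinner (A x) x) \<le> l n * (norm x)\<^sup>2"
  proof (rule has_sum_mono[OF eigenbasis_form[OF A xS] has_sum_cmult_right[OF parseval_norm[OF b]]])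
    fix j :: nat assume j: "j \<in> {1..}"
    show "l j * (cmod (cinner x (f j)))\<^sup>2 \<le> l n * (cmod (cinner x (f j)))\<^sup>2"
      using 0[of j] j mono_onD[OF mono(1), of j n] n by (cases "j > n") (auto intro: mult_right_mono)
  qed
  moreover have "l' n * (norm x)\<^sup>2 \<le> Re (cinner (A' x) x)"
  proof (rule has_sum_mono[OF has_sum_cmult_right[OF parseval_norm[OF b']] eigenbasis_form[OF A' xS]])
    fix j :: nat assume j: "j \<in> {1..}"
    show "l' n * (cmod (cinner x (f' j)))\<^sup>2 \<le> l' j * (cmod (cinner x (f' j)))\<^sup>2"
      using x(3)[of j] j mono_onD[OF mono(2), of n j] n by (cases "j < n") (auto intro: mult_right_mono)
  qed
  moreover have "Re (cinner (A' x) x) - Re (cinner (A x) x) \<le> q"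
  proof -
    have "Re (cinner (A' x - A x) x) \<le> norm (A' x - A x) * norm x"
      using norm_cinner_le[of "A' x - A x" x] complex_Re_le_cmod order.trans by blast
    then show ?thesis using q[OF xS] x(2) by (simp add: cinner_diff_left)
  qed
  ultimately show ?thesis using x(2) by simp
qed

text \<open>Since \<open>w\<close> tends to 0, truncation to finitely many coordinates approximates
  \<open>G\<close> uniformly on the ball, and the truncated images lie in compact sets; hence the
  image is totally bounded.\<close>

lemma diagonal_compact:
  fixes e :: "nat \<Rightarrow> 'a::chilbert_space"
  assumes e: "orthonormal_basis e"
    and G: "\<And>x i. i \<ge> 1 \<Longrightarrow> cinner (G x) (e i) = complex_of_real (w i) * cinner x (e i)"
    and w: "w \<longlonglongrightarrow> 0" "\<And>i. i \<ge> 1 \<Longrightarrow> \<bar>w i\<bar> \<le> W"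
  shows "compact (closure (G ` cball 0 K))"
proof -
  have W: "W \<ge> 0" using w(2)[of 1] by simp
  \<comment> \<open>A finite-dimensional polydisc. The radius \<open>W * K\<close> bounds every
    coordinate of \<open>G x\<close> for \<open>x\<close> in the ball.\<close>
  define Z where "Z N = {\<Sum>i=1..N. c i *\<^sub>C e i | c. \<forall>i\<in>{1..N}. cmod (c i) \<le> W * K}" for N
  have Z: "compact (Z N)" for N
  proof (induction N)
    case 0
    then show ?case by (simp add: Z_def)
  next
    case (Suc N)
    let ?L = "(\<lambda>c. c *\<^sub>C e (Suc N)) ` cball 0 (W * K)"
    have "compact ?L"
      by (intro compact_continuous_image compact_cball scaleC.continuous_on continuous_intros)
    from compact_sums[OF Suc this] have "compact {x + y |x y. x \<in> Z N \<and> y \<in> ?L}" .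
    moreover have "Z (Suc N) = {x + y |x y. x \<in> Z N \<and> y \<in> ?L}"
    proof (intro set_eqI iffI)
      fix v assume "v \<in> Z (Suc N)"
      then obtain c where c: "v = (\<Sum>i=1..Suc N. c i *\<^sub>C e i)" "\<forall>i\<in>{1..Suc N}. cmod (c i) \<le> W * K"
        by (auto simp: Z_def)
      then have "v = (\<Sum>i=1..N. c i *\<^sub>C e i) + c (Suc N) *\<^sub>C e (Suc N)" by simp
      moreover have "(\<Sum>i=1..N. c i *\<^sub>C e i) \<in> Z N" using c(2) by (auto simp: Z_def)
      moreover have "c (Suc N) *\<^sub>C e (Suc N) \<in> ?L" using c(2) by auto
      ultimately show "v \<in> {x + y |x y. x \<in> Z N \<and> y \<in> ?L}" by blast
    next
      fix v assume "v \<in> {x + y |x y. x \<in> Z N \<and> y \<in> ?L}"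
      then obtain c d where c: "v = (\<Sum>i=1..N. c i *\<^sub>C e i) + d *\<^sub>C e (Suc N)"
          "\<forall>i\<in>{1..N}. cmod (c i) \<le> W * K" "cmod d \<le> W * K"
        by (auto simp: Z_def)
      let ?c = "c(Suc N := d)"
      have "v = (\<Sum>i=1..Suc N. ?c i *\<^sub>C e i)"
        unfolding c(1) by simp
      moreover have "\<forall>i\<in>{1..Suc N}. cmod (?c i) \<le> W * K" using c(2,3) by auto
      ultimately show "v \<in> Z (Suc N)" unfolding Z_def by blast
    qed
    ultimately show ?case by simp
  qed
  have Gnorm: "norm (G x) \<le> W * norm x" for x
    by (rule norm_le_coordinates[OF e W]) (use w(2) in \<open>auto simp: G norm_mult intro: mult_right_mono\<close>)
  have approx: "\<exists>N. \<forall>x\<in>cball 0 K. \<exists>p\<in>Z N. norm (G x - p) \<le> \<epsilon>" if "\<epsilon> > 0" for \<epsilon>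
  proof -
    \<comment> \<open>\<open>\<bar>K\<bar> + 1\<close> is a positive bound for the norms in the
      ball, whatever the sign of \<open>K\<close>.\<close>
    have "\<epsilon> / (\<bar>K\<bar> + 1) > 0" using that by simp
    from LIMSEQ_D[OF w(1) this]
    obtain N where N: "\<And>i. i \<ge> N \<Longrightarrow> \<bar>w i\<bar> < \<epsilon> / (\<bar>K\<bar> + 1)" by auto
    have "\<exists>p\<in>Z N. norm (G x - p) \<le> \<epsilon>" if x: "x \<in> cball 0 K" for x
    proof (intro bexI)
      let ?p = "\<Sum>i=1..N. cinner (G x) (e i) *\<^sub>C e i"
      have "W * norm x \<le> W * K" using x W by (intro mult_left_mono) auto
      then show "?p \<in> Z N"
        unfolding Z_def using norm_coordinate_le[OF e, of _ "G x"] Gnorm[of x] by force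
      have "norm (G x - ?p) \<le> \<epsilon> / (\<bar>K\<bar> + 1) * norm x"
      proof (rule norm_le_coordinates[OF e])
        fix i :: nat assume i: "i \<ge> 1"
        have "cinner ?p (e i) = (if i \<in> {1..N} then cinner (G x) (e i) else 0)"
          using i by (intro cinner_partial_sum[OF e]) auto
        then show "cmod (cinner (G x - ?p) (e i)) \<le> \<epsilon> / (\<bar>K\<bar> + 1) * cmod (cinner x (e i))"
          using mult_right_mono[of "\<bar>w i\<bar>" "\<epsilon> / (\<bar>K\<bar> + 1)" "cmod (cinner x (e i))"] N[of i] i \<open>\<epsilon> > 0\<close>
          by (cases "i \<le> N") (auto simp: cinner_diff_left G[OF i] norm_mult)
      qed (use \<open>\<epsilon> > 0\<close> in simp)
      also have "\<dots> \<le> \<epsilon> / (\<bar>K\<bar> + 1) * (\<bar>K\<bar> + 1)"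
        using x \<open>\<epsilon> > 0\<close> by (intro mult_left_mono) auto
      finally show "norm (G x - ?p) \<le> \<epsilon>" by simp
    qed
    then show ?thesis by blast
  qed
  show ?thesis
    unfolding compact_eq_totally_bounded
  proof (intro conjI allI impI)
    show "complete (closure (G ` cball 0 K))" by (simp add: complete_eq_closed)
    fix \<epsilon> :: real assume "\<epsilon> > 0"
    \<comment> \<open>Two errors of \<epsilon>/4 give closed balls of radius \<epsilon>/2; being
      closed, their finite union also contains the closure.\<close>
    then have \<epsilon>: "\<epsilon> / 4 > 0" by simp
    obtain N where N: "\<And>x. x \<in> cball 0 K \<Longrightarrow> \<exists>p\<in>Z N. norm (G x - p) \<le> \<epsilon> / 4"
      using approx[OF \<epsilon>] by blast
    obtain k where k: "finite k" "Z N \<subseteq> (\<Union>x\<in>k. ball x (\<epsilon> / 4))"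
      using Z[of N] \<epsilon> unfolding compact_eq_totally_bounded by meson
    have "G ` cball 0 K \<subseteq> (\<Union>x\<in>k. cball x (\<epsilon> / 2))"
    proof
      fix v assume "v \<in> G ` cball 0 K"
      then obtain p where p: "p \<in> Z N" "norm (v - p) \<le> \<epsilon> / 4" using N by blast
      then obtain x where x: "x \<in> k" "dist x p < \<epsilon> / 4" using k(2) by auto
      have "dist x v \<le> dist x p + norm (v - p)"
        by (metis dist_commute dist_norm dist_triangle)
      then show "v \<in> (\<Union>x\<in>k. cball x (\<epsilon> / 2))" using x p by (intro UN_I[of x]) auto
    qed
    then have "closure (G ` cball 0 K) \<subseteq> (\<Union>x\<in>k. cball x (\<epsilon> / 2))"
      using k(1) by (intro closure_minimal closed_UN) auto
    also have "\<dots> \<subseteq> (\<Union>x\<in>k. ball x \<epsilon>)"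
      using \<open>\<epsilon> > 0\<close> by (fastforce)
    finally show "\<exists>k. finite k \<and> closure (G ` cball 0 K) \<subseteq> (\<Union>x\<in>k. ball x \<epsilon>)"
      using k(1) by blast
  qed
qed

section \<open>The compact resolvent of the perturbed number operator\<close>

locale number_operator =
  fixes S :: "'a::chilbert_space set" and D :: "'a \<Rightarrow> 'a" and e :: "nat \<Rightarrow> 'a"
  assumes selfadjoint: "selfadjoint_on S D"
    and basis: "orthonormal_basis e"
    and eigen: "\<And>n. n \<ge> 1 \<Longrightarrow> e n \<in> S \<and> D (e n) = of_nat n *\<^sub>C e n"
begin

lemma eigenbasis: "eigenbasis e real S D"
  using basis eigen by (auto simp: eigenbasis_def mono_on_def filterlim_real_sequentially)

text \<open>Left of the spectrum the inverse \<open>B\<close> of \<open>D + R + c\<close> is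
  obtained by a contraction argument from the diagonal inverse \<open>G\<close> of
  \<open>D + c\<close>. It is positive and compact, and its eigenvectors are those of
  \<open>D + R\<close>.\<close>

lemma exists_eigenbasis:
  assumes R: "selfadjoint_on UNIV R" and C: "\<And>x. norm (R x) \<le> C * norm x"
  shows "\<exists>f l. eigenbasis f l S (\<lambda>x. D x + R x)"
proof -
  have linR: "R (x + y) = R x + R y" "R (a *\<^sub>C x) = a *\<^sub>C R x" for x y a
    using R by (auto simp: selfadjoint_on_def clinear_on_def)
  have R_diff: "R (x - y) = R x - R y" for x y
    using linR(1)[of "x - y" y] by simp
  have linD: "csubspace S" "\<And>x y. x \<in> S \<Longrightarrow> y \<in> S \<Longrightarrow> D (x + y) = D x + D y"
    "\<And>a x. x \<in> S \<Longrightarrow> D (a *\<^sub>C x) = a *\<^sub>C D x"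
    using selfadjoint by (auto simp: selfadjoint_on_def clinear_on_def)
  have "C \<ge> 0"
    using order.trans[OF norm_ge_zero C[of "e 1"]]
      orthonormal_norm[OF orthonormal_basis_on[OF basis order_refl], of 1] by simp
  \<comment> \<open>Any \<open>c > C\<close> makes the fixed point map a contraction;
    \<open>C + 1\<close> also makes \<open>D + R + c\<close> bounded below by 1, because
    \<open>D\<close> is nonnegative.\<close>
  define c where "c = C + 1"
  have c: "c > 0" "C < c" using \<open>C \<ge> 0\<close> by (auto simp: c_def)
  define T where "T x = D x + R x" for x
  have T: "selfadjoint_on S T"
    unfolding T_def by (rule selfadjoint_on_add_bounded[OF selfadjoint R])
  have "\<exists>z. \<forall>i\<ge>1. cinner z (e i) = complex_of_real (1 / (real i + c)) * cinner y (e i)" for y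
  proof (rule riesz_fischer_multiplier[OF basis, where C = "1 / c"])
    fix i :: nat
    have "\<bar>1 / (real i + c)\<bar> \<le> 1 / c" using c by (auto simp: divide_simps)
    then show "cmod (complex_of_real (1 / (real i + c))) \<le> 1 / c"
      by (simp only: norm_of_real real_norm_def)
  qed
  then obtain G where G: "\<And>y i. i \<ge> 1 \<Longrightarrow> cinner (G y) (e i) = complex_of_real (1 / (real i + c)) * cinner y (e i)"
    by metis
  have ic: "complex_of_real (real i + c) \<noteq> 0" for i
    using c by (simp del: of_real_add)
  have G_D: "G y \<in> S \<and> D (G y) = y - c *\<^sub>R G y" for y
  proof -
    have "cinner (y - c *\<^sub>R G y) (e j) = complex_of_real (real j) * cinner (G y) (e j)" if "j \<ge> 1" for j
      using ic[of j] that by (simp add: cinner_diff_left cinner_scaleR_left G divide_simps) (simp add: algebra_simps)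
    from eigenbasis_domainI[OF selfadjoint eigenbasis this] show ?thesis by blast
  qed
  have D_G: "G (D x + c *\<^sub>R x) = x" if "x \<in> S" for x
  proof (rule basis_eqI[OF basis])
    fix i :: nat assume i: "1 \<le> i"
    show "cinner (G (D x + c *\<^sub>R x)) (e i) = cinner x (e i)"
      using ic[of i] by (simp add: G[OF i] cinner_add_left cinner_scaleR_left
          eigenbasis_coordinate[OF selfadjoint eigenbasis that i] field_simps)
  qed
  have G_norm: "norm (G y) \<le> (1 / c) * norm y" for y
  proof (rule norm_le_coordinates[OF basis])
    fix i :: nat assume i: "1 \<le> i"
    have "\<bar>1 / (real i + c)\<bar> \<le> 1 / c" using c by (auto simp: divide_simps)
    then show "cmod (cinner (G y) (e i)) \<le> (1 / c) * cmod (cinner y (e i))"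
      unfolding G[OF i] norm_mult norm_of_real by (intro mult_right_mono) auto
  qed (use c in simp)
  have G_diff: "G (x - y) = G x - G y" for x y
    by (rule basis_eqI[OF basis]) (simp add: G cinner_diff_left algebra_simps)
  \<comment> \<open>The equation (D + R + c) x = y in fixed point form; uniqueness makes
    \<open>B\<close> a function and injectivity of D + R + c immediate.\<close>
  have "\<exists>!x. G (y - R x) = x" for y
  proof (rule banach_fix_type)
    show "0 \<le> C / c" "C / c < 1" using c \<open>C \<ge> 0\<close> by auto
    show "\<forall>u v. dist (G (y - R u)) (G (y - R v)) \<le> C / c * dist u v"
    proof (intro allI)
      fix u v
      have "G (y - R u) - G (y - R v) = G (R (v - u))"
        by (simp add: G_diff[symmetric] R_diff)
      then have "dist (G (y - R u)) (G (y - R v)) \<le> 1 / c * norm (R (v - u))"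
        using G_norm by (simp add: dist_norm)
      also have "\<dots> \<le> 1 / c * (C * norm (v - u))"
        using C c by (intro mult_left_mono) auto
      finally show "dist (G (y - R u)) (G (y - R v)) \<le> C / c * dist u v"
        by (simp add: dist_norm norm_minus_commute)
    qed
  qed
  then obtain B where B: "\<And>y x. G (y - R x) = x \<longleftrightarrow> x = B y"
    by metis
  have B_iff: "B y = x \<longleftrightarrow> x \<in> S \<and> T x + c *\<^sub>R x = y" for x y
  proof
    assume "B y = x"
    then have "G (y - R x) = x" using B by blast
    then show "x \<in> S \<and> T x + c *\<^sub>R x = y" using G_D[of "y - R x"] by (simp add: T_def)
  next
    assume x: "x \<in> S \<and> T x + c *\<^sub>R x = y"
    then have "y - R x = D x + c *\<^sub>R x" by (auto simp: T_def)
    then show "B y = x" using D_G[of x] x B by metis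
  qed
  then have B_S: "B y \<in> S" and TB: "T (B y) + c *\<^sub>R B y = y" for y by blast+
  \<comment> \<open>The fixed point equation gives (c - C) times the norm of \<open>B y\<close> as
    at most the norm of \<open>y\<close>, and \<open>c - C = 1\<close>.\<close>
  have B_norm: "norm (B y) \<le> norm y" for y
  proof -
    have "norm (B y) \<le> 1 / c * norm (y - R (B y))"
      using B[of y "B y"] G_norm by metis
    also have "\<dots> \<le> 1 / c * (norm y + C * norm (B y))"
      using c C[of "B y"] norm_triangle_ineq4[of y "R (B y)"] by (intro mult_left_mono) auto
    finally show ?thesis using c by (simp add: field_simps c_def)
  qed
  interpret positive_compact B
  proof
    fix x y a
    show "B (x + y) = B x + B y"
    proof -
      have "T (B x + B y) + c *\<^sub>R (B x + B y) = (T (B x) + c *\<^sub>R B x) + (T (B y) + c *\<^sub>R B y)"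
        using B_S[of x] B_S[of y] by (simp add: T_def linD linR scaleR_add_right)
      then show ?thesis
        unfolding B_iff using B_S[of x] B_S[of y] linD(1) by (simp add: TB complex_vector.subspace_add)
    qed
    show "B (a *\<^sub>C x) = a *\<^sub>C B x"
    proof -
      have "T (a *\<^sub>C B x) + c *\<^sub>R (a *\<^sub>C B x) = a *\<^sub>C (T (B x) + c *\<^sub>R B x)"
        using B_S[of x] by (simp add: T_def linD linR scaleC_add_right scaleR_eq_scaleC scaleC_scaleC mult.commute)
      then show ?thesis
        unfolding B_iff using B_S[of x] linD(1) by (simp add: TB complex_vector.subspace_scale)
    qed
    show "\<exists>C. \<forall>x. norm (B x) \<le> C * norm x" using B_norm by (intro exI[of _ 1]) simp
    show "cinner (B x) y = cinner x (B y)"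
    proof -
      have "cinner (B x) (T (B y) + c *\<^sub>R B y) = cinner (T (B x) + c *\<^sub>R B x) (B y)"
        using selfadjoint_onD[OF T B_S[of x] B_S[of y]]
        by (simp add: cinner_add_left cinner_add_right cinner_scaleR_left cinner_scaleR_right)
      then show ?thesis by (simp add: TB)
    qed
    \<comment> \<open>With z = B x this is the form of D + R + c at z: the part \<open>C\<close> of
      \<open>c\<close> compensates \<open>R\<close>.\<close>
    show "0 \<le> Re (cinner (B x) x)"
    proof -
      let ?z = "B x"
      have "0 \<le> Re (cinner (D ?z) ?z)"
        by (rule has_sum_nonneg[OF eigenbasis_form[OF selfadjoint eigenbasis B_S]]) simp
      moreover have "- (C * (norm ?z)\<^sup>2) \<le> Re (cinner (R ?z) ?z)"
      proof -
        have "\<bar>Re (cinner (R ?z) ?z)\<bar> \<le> norm (R ?z) * norm ?z"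
          using norm_cinner_le abs_Re_le_cmod order.trans by blast
        also have "\<dots> \<le> C * norm ?z * norm ?z" using C by (intro mult_right_mono) auto
        finally show ?thesis by (simp add: power2_eq_square)
      qed
      moreover have "Re (cinner (B x) x) = Re (cinner (T ?z + c *\<^sub>R ?z) ?z)"
        by (subst (2) TB[of x, symmetric], subst cinner_commute) simp
      moreover have "Re (cinner (T ?z + c *\<^sub>R ?z) ?z)
          = Re (cinner (D ?z) ?z) + Re (cinner (R ?z) ?z) + C * (norm ?z)\<^sup>2 + (norm ?z)\<^sup>2"
        by (simp add: T_def cinner_add_left cinner_scaleR_left cinner_self_eq_norm c_def algebra_simps)
      ultimately show ?thesis using zero_le_power2[of "norm ?z"] by linarith
    qed
    show "x = 0" if "B x = 0"
    proof -
      have "0 \<in> S" using linD(1) complex_vector.subspace_0 by blast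
      then have "D 0 = 0" using linD(2)[of 0 0] by simp
      moreover have "R 0 = 0" using linR(1)[of 0 0] by simp
      ultimately show ?thesis using TB[of x] that by (simp add: T_def)
    qed
    show "\<exists>r z. strict_mono r \<and> (\<lambda>n. B (u (r n))) \<longlonglongrightarrow> z" if u: "\<And>n. norm (u n) \<le> 1" for u :: "nat \<Rightarrow> 'a"
    proof -
      have "(\<lambda>i. 1 / (real i + c)) \<longlonglongrightarrow> 0"
        using filterlim_tendsto_add_at_top[OF tendsto_const[of c] filterlim_real_sequentially]
        by (intro tendsto_divide_0[OF tendsto_const filterlim_at_top_imp_at_infinity]) (simp add: add.commute)
      then have "compact (closure (G ` cball 0 (1 + C)))"
        using c by (intro diagonal_compact[OF basis G, where W = "1 / c"]) (auto simp: divide_simps)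
      \<comment> \<open>Compactness is inherited from \<open>G\<close> because B u = G (u - R (B
        u)), with an argument of norm at most 1 + C.\<close>
      moreover have "B (u n) \<in> closure (G ` cball 0 (1 + C))" for n
      proof -
        have "norm (R (B (u n))) \<le> C * 1"
          using C[of "B (u n)"] B_norm[of "u n"] u[of n] \<open>C \<ge> 0\<close> by (meson mult_left_mono order.trans)
        then have "u n - R (B (u n)) \<in> cball 0 (1 + C)"
          using u[of n] norm_triangle_ineq4[of "u n" "R (B (u n))"] by simp
        moreover have "B (u n) = G (u n - R (B (u n)))" using B by metis
        ultimately have "B (u n) \<in> G ` cball 0 (1 + C)" by (rule image_eqI[rotated])
        then show ?thesis by (rule subsetD[OF closure_subset])
      qed
      ultimately obtain z r where "strict_mono r" "((\<lambda>n. B (u n)) \<circ> r) \<longlonglongrightarrow> z"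
        using seq_compactE[OF compact_imp_seq_compact, of "closure (G ` cball 0 (1 + C))" "\<lambda>n. B (u n)"]
        by metis
      then show ?thesis by (auto simp: o_def)
    qed
    have "range B = S"
    proof
      show "S \<subseteq> range B" using B_iff by (metis rangeI subsetI)
    qed (use B_S in auto)
    then show "closure (range B) = UNIV"
      using selfadjoint by (simp add: selfadjoint_on_def)
  qed
  obtain f \<beta> where f: "orthonormal_basis f" "\<And>j. j \<ge> 1 \<Longrightarrow> \<beta> j > 0 \<and> B (f j) = complex_of_real (\<beta> j) *\<^sub>C f j"
    "\<And>i j. i \<ge> 1 \<Longrightarrow> j \<ge> i \<Longrightarrow> \<beta> j \<le> \<beta> i" "\<beta> \<longlonglongrightarrow> 0"
    using spectral[OF basis] by blast
  \<comment> \<open>From B f = \<beta> f follows (D + R) f = (1/\<beta> - c) f; decreasing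
    \<open>\<beta>\<close> with limit 0 become increasing eigenvalues with limit infinity.\<close>
  have "eigenbasis f (\<lambda>j. inverse (\<beta> j) - c) S T"
    unfolding eigenbasis_def
  proof (intro conjI allI impI f(1))
    fix j :: nat assume j: "1 \<le> j"
    let ?b = "complex_of_real (\<beta> j)"
    have b: "?b \<noteq> 0" and *: "B (f j) = ?b *\<^sub>C f j" using f(2)[OF j] by auto
    have fj: "f j = complex_of_real (inverse (\<beta> j)) *\<^sub>C B (f j)" using b by (simp add: * scaleC_scaleC)
    show fS: "f j \<in> S"
      by (subst fj) (intro complex_vector.subspace_scale[OF linD(1)] B_S)
    have "f j = T (?b *\<^sub>C f j) + c *\<^sub>R (?b *\<^sub>C f j)" using TB[of "f j"] by (simp add: *)
    also have "\<dots> = ?b *\<^sub>C (T (f j) + c *\<^sub>R f j)"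
      using fS by (simp add: T_def linD linR scaleC_add_right scaleR_eq_scaleC scaleC_scaleC mult.commute)
    finally have "inverse ?b *\<^sub>C f j = T (f j) + c *\<^sub>R f j"
      using b by (metis left_inverse scaleC_scaleC complex_vector.scale_one)
    then show "T (f j) = complex_of_real (inverse (\<beta> j) - c) *\<^sub>C f j"
      by (simp add: scaleC.diff_left scaleR_eq_scaleC)
  next
    show "mono_on {1..} (\<lambda>j. inverse (\<beta> j) - c)"
      using f(2,3) by (intro mono_onI) (auto intro!: le_imp_inverse_le)
    have "eventually (\<lambda>j. \<beta> j > 0) sequentially"
      using eventually_ge_at_top[of 1] by eventually_elim (use f(2) in auto)
    with f(4) have "filterlim (\<lambda>j. inverse (\<beta> j)) at_top sequentially"
      by (rule filterlim_inverse_at_top)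
    then show "filterlim (\<lambda>j. inverse (\<beta> j) - c) at_top sequentially"
      using filterlim_tendsto_add_at_top[OF tendsto_const[of "- c"]] by (simp add: add.commute)
  qed
  then show ?thesis unfolding T_def by blast
qed

end

section \<open>Localization of the eigenvalues\<close>

lemma abs_inverse_le:
  fixes b c d :: real
  assumes "0 < b" "b \<le> c * \<bar>d\<bar>"
  shows "\<bar>1 / d\<bar> \<le> c / b"
proof -
  have "\<bar>d\<bar> > 0" using assms by auto
  then show ?thesis using assms by (simp add: divide_simps mult.commute)
qed

text \<open>For negative \<open>p\<close> the column index truncates to 0 for finitely many
  \<open>n\<close> only, so the limits are not affected.\<close>

locale vanishing_diagonals = number_operator S D e
  for S :: "'a::chilbert_space set" and D e +
  fixes R :: "'a \<Rightarrow> 'a" and C :: real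
  assumes R: "selfadjoint_on UNIV R"
    and C: "norm (R x) \<le> C * norm x"
    and diagonals: "(\<lambda>n. matrix_entry e R n (nat (int n + p))) \<longlonglongrightarrow> 0"
begin

lemma R_add: "R (x + y) = R x + R y"
  and R_scaleC: "R (c *\<^sub>C x) = c *\<^sub>C R x"
  using R by (auto simp: selfadjoint_on_def clinear_on_def)

lemma R_diff: "R (x - y) = R x - R y"
  using R_add[of "x - y" y] by simp

lemma R_sum: "R (\<Sum>i\<in>F. c i *\<^sub>C x i) = (\<Sum>i\<in>F. c i *\<^sub>C R (x i))"
proof (induction F rule: infinite_finite_induct)
  case empty
  show ?case using R_add[of 0 0] by simp
next
  case (infinite F)
  then show ?case using R_add[of 0 0] by simp
qed (simp add: R_add R_scaleC)

lemma R_symmetric: "cinner (R x) y = cinner x (R y)"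
  using selfadjoint_onD[OF R] by simp

lemma norm_e: "i \<ge> 1 \<Longrightarrow> norm (e i) = 1"
  using orthonormal_norm[OF orthonormal_basis_on[OF basis order_refl]] by simp

lemma C_nonneg: "C \<ge> 0"
  using order.trans[OF norm_ge_zero C[of "e 1"]] norm_e[of 1] by simp

lemma cinner_R_le: "cmod (cinner (R x) y) \<le> C * norm x * norm y"
  using order.trans[OF norm_cinner_le mult_right_mono[OF C norm_ge_zero]] .

text \<open>A block of half-width \<open>M\<close> meets only the diagonals with |p| at most 2 M.
  Finitely many null sequences are small simultaneously, and all rows of the block are late once
  \<open>n\<close> is at least \<open>N + M\<close>.\<close>

lemma block_small:
  assumes "\<delta> > 0"
  shows "\<exists>N. \<forall>n\<ge>N. \<forall>i\<in>{n - M..n + M}. \<forall>j\<in>{n - M..n + M}. cmod (matrix_entry e R i j) \<le> \<delta>"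
proof -
  have "\<forall>\<^sub>F i in sequentially. \<forall>p\<in>{- 2 * int M..2 * int M}. cmod (matrix_entry e R i (nat (int i + p))) < \<delta>"
    using tendstoD[OF diagonals assms] by (intro eventually_ball_finite) auto
  then obtain N where N: "\<And>i p. i \<ge> N \<Longrightarrow> p \<in> {- 2 * int M..2 * int M} \<Longrightarrow>
      cmod (matrix_entry e R i (nat (int i + p))) < \<delta>"
    unfolding eventually_sequentially by blast
  have "cmod (matrix_entry e R i j) \<le> \<delta>"
    if "n \<ge> N + M" "i \<in> {n - M..n + M}" "j \<in> {n - M..n + M}" for n i j
  proof -
    have "N \<le> i" "int j - int i \<in> {- 2 * int M..2 * int M}" using that by auto
    from N[OF this] show ?thesis by simp
  qed
  then show ?thesis by blast
qed

text \<open>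
  The multiplier \<open>w\<close> is concentrated near \<open>n\<close>, and there the matrix of \<open>R\<close> is small for large \<open>n\<close>.
\<close>

lemma sandwich_small:
  assumes "\<eta> > 0"
  shows "\<exists>N. \<forall>n\<ge>N. \<forall>w g h x y. (\<forall>i\<ge>1. \<bar>w i\<bar> \<le> 4 / (1 + \<bar>real i - real n\<bar>)) \<longrightarrow>
    (\<forall>i\<ge>1. cinner g (e i) = complex_of_real (w i) * cinner x (e i)) \<longrightarrow>
    (\<forall>i\<ge>1. cinner h (e i) = complex_of_real (w i) * cinner y (e i)) \<longrightarrow>
    cmod (cinner (R g) h) \<le> \<eta> * norm x * norm y"
proof -
  \<comment> \<open>Makes \<open>\<kappa>\<close>, the bound for each of the two tail terms, at most
    \<eta>/4.\<close>
  obtain M :: nat where M: "64 * C / \<eta> < real M" using reals_Archimedean2 by blast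
  define c where "c = 2 * real M + 1"
  have c: "c > 0" by (simp add: c_def)
  define \<kappa> where "\<kappa> = 16 * C / (1 + real M)"
  have \<kappa>: "2 * \<kappa> + \<eta> / 2 \<le> \<eta>"
    using M assms by (simp add: \<kappa>_def field_simps)
  \<comment> \<open>The block has c^2 entries, each contributing at most 16 \<delta>, where 16 = 4 *
    4 comes from the two weights: together \<eta>/2.\<close>
  define \<delta> where "\<delta> = \<eta> / (32 * c\<^sup>2)"
  have \<delta>: "\<delta> > 0" using assms c by (simp add: \<delta>_def)
  obtain N where N: "\<And>n i j. n \<ge> N \<Longrightarrow> i \<in> {n - M..n + M} \<Longrightarrow> j \<in> {n - M..n + M} \<Longrightarrow>
      cmod (matrix_entry e R i j) \<le> \<delta>"
    using block_small[OF \<delta>, of M] by blast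
  show ?thesis
  \<comment> \<open>The summand \<open>M + 1\<close> keeps the window \<open>F\<close> inside the
    indices from 1 on, so that subtraction does not truncate.\<close>
  proof (intro exI[of _ "N + M + 1"] allI impI)
    fix n :: nat and w :: "nat \<Rightarrow> real" and g h x y :: 'a
    assume n: "N + M + 1 \<le> n"
      and w: "\<forall>i\<ge>1. \<bar>w i\<bar> \<le> 4 / (1 + \<bar>real i - real n\<bar>)"
      and g: "\<forall>i\<ge>1. cinner g (e i) = complex_of_real (w i) * cinner x (e i)"
      and h: "\<forall>i\<ge>1. cinner h (e i) = complex_of_real (w i) * cinner y (e i)"
    define F where "F = {n - M..n + M}"
    have F: "finite F" "F \<subseteq> {1..}" "card F = 2 * M + 1" using n by (auto simp: F_def)
    define P where "P v = (\<Sum>i\<in>F. cinner v (e i) *\<^sub>C e i)" for v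
    have P: "cinner (P v) (e i) = (if i \<in> F then cinner v (e i) else 0)" if "i \<ge> 1" for v i
      unfolding P_def by (rule cinner_partial_sum[OF basis F(1,2) that])
    have w4: "\<bar>w i\<bar> \<le> 4" if "i \<ge> 1" for i
    proof -
      have "4 / (1 + \<bar>real i - real n\<bar>) \<le> 4" by (simp add: divide_simps)
      then show ?thesis using w that by (meson order.trans)
    qed
    have w_far: "\<bar>w i\<bar> \<le> 4 / (1 + real M)" if "i \<ge> 1" "i \<notin> F" for i
    proof -
      have "real M \<le> \<bar>real i - real n\<bar>" using that n by (auto simp: F_def)
      then have "4 / (1 + \<bar>real i - real n\<bar>) \<le> 4 / (1 + real M)"
        by (intro divide_left_mono) auto
      then show ?thesis using w that by (meson order.trans)
    qed
    have full: "norm k \<le> 4 * norm z"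
      and cut: "norm (P k) \<le> 4 * norm z"
      and tail: "norm (k - P k) \<le> 4 / (1 + real M) * norm z"
      if k: "\<forall>i\<ge>1. cinner k (e i) = complex_of_real (w i) * cinner z (e i)" for k z
    proof -
      show "norm k \<le> 4 * norm z"
        by (rule norm_le_coordinates[OF basis])
          (use w4 in \<open>auto simp: k norm_mult intro: mult_right_mono\<close>)
      show "norm (P k) \<le> 4 * norm z"
        by (rule norm_le_coordinates[OF basis])
          (use w4 in \<open>auto simp: P k norm_mult intro: mult_right_mono\<close>)
      show "norm (k - P k) \<le> 4 / (1 + real M) * norm z"
      proof (rule norm_le_coordinates[OF basis])
        fix i :: nat assume i: "i \<ge> 1"
        show "cmod (cinner (k - P k) (e i)) \<le> 4 / (1 + real M) * cmod (cinner z (e i))"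
          using mult_right_mono[OF w_far[OF i] norm_ge_zero[of "cinner z (e i)"]]
          by (cases "i \<in> F") (auto simp: cinner_diff_left P[OF i] k[rule_format, OF i] norm_mult)
      qed simp
    qed
    have "cmod (cinner (R (g - P g)) h) \<le> C * norm (g - P g) * norm h"
      by (rule cinner_R_le)
    also have "\<dots> \<le> C * (4 / (1 + real M) * norm x) * (4 * norm y)"
      using C_nonneg by (intro mult_mono mult_left_mono tail[OF g] full[OF h]) auto
    finally have 1: "cmod (cinner (R (g - P g)) h) \<le> \<kappa> * (norm x * norm y)"
      by (simp add: \<kappa>_def)
    have "cmod (cinner (R (P g)) (h - P h)) \<le> C * norm (P g) * norm (h - P h)"
      by (rule cinner_R_le)
    also have "\<dots> \<le> C * (4 * norm x) * (4 / (1 + real M) * norm y)"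
      using C_nonneg by (intro mult_mono mult_left_mono tail[OF h] cut[OF g]) auto
    finally have 2: "cmod (cinner (R (P g)) (h - P h)) \<le> \<kappa> * (norm x * norm y)"
      by (simp add: \<kappa>_def)
    have "cmod (cinner (R (P g)) (P h))
        = cmod (\<Sum>j\<in>F. \<Sum>i\<in>F. cinner g (e j) * (cnj (cinner h (e i)) * matrix_entry e R i j))"
      unfolding P_def[of g] P_def[of h] R_sum
      by (simp add: cinner.sum_left cinner.sum_right cinner_scaleC_left cinner_scaleC_right
          matrix_entry_def sum_distrib_left) (subst sum.swap, simp add: mult_ac)
    also have "\<dots> \<le> (\<Sum>j\<in>F. \<Sum>i\<in>F. 16 * \<delta> * (norm x * norm y))"
    proof (intro sum_norm_le)
      fix i j assume ij: "i \<in> F" "j \<in> F"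
      then have ge: "i \<ge> 1" "j \<ge> 1" using F(2) by auto
      have coord: "cmod (cinner k (e i)) \<le> 4 * norm z"
        if "\<forall>i\<ge>1. cinner k (e i) = complex_of_real (w i) * cinner z (e i)" "i \<ge> 1" for k z i
        using norm_coordinate_le[OF basis that(2), of k] full[OF that(1)] by simp
      have "cmod (matrix_entry e R i j) \<le> \<delta>"
        using N[of n i j] n ij by (simp add: F_def)
      then have "cmod (cinner g (e j)) * (cmod (cinner h (e i)) * cmod (matrix_entry e R i j))
          \<le> (4 * norm x) * ((4 * norm y) * \<delta>)"
        by (intro mult_mono coord[OF g ge(2)] coord[OF h ge(1)]) auto
      then show "cmod (cinner g (e j) * (cnj (cinner h (e i)) * matrix_entry e R i j))
          \<le> 16 * \<delta> * (norm x * norm y)"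
        by (simp add: norm_mult mult_ac)
    qed
    also have "\<dots> = \<eta> / 2 * (norm x * norm y)"
    proof -
      have "real (card F) = c" using F(3) by (simp add: c_def)
      then show ?thesis using c by (simp add: \<delta>_def power2_eq_square)
    qed
    finally have 3: "cmod (cinner (R (P g)) (P h)) \<le> \<eta> / 2 * (norm x * norm y)" .
    \<comment> \<open>Two terms with a far factor, small by the decay of the weights, and the block
      term, small by the vanishing diagonals.\<close>
    have "cinner (R g) h = cinner (R (g - P g)) h + cinner (R (P g)) (h - P h) + cinner (R (P g)) (P h)"
      by (simp add: R_diff cinner_diff_left cinner_diff_right)
    then have "cmod (cinner (R g) h)
        \<le> cmod (cinner (R (g - P g)) h) + cmod (cinner (R (P g)) (h - P h)) + cmod (cinner (R (P g)) (P h))"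
      by (simp only:) (rule order.trans[OF norm_triangle_ineq add_right_mono[OF norm_triangle_ineq]])
    also have "\<dots> \<le> \<kappa> * (norm x * norm y) + \<kappa> * (norm x * norm y) + \<eta> / 2 * (norm x * norm y)"
      by (intro add_mono 1 2 3)
    also have "\<dots> = (2 * \<kappa> + \<eta> / 2) * (norm x * norm y)"
      by (simp add: distrib_right)
    also have "\<dots> \<le> \<eta> * (norm x * norm y)"
      by (rule mult_right_mono[OF \<kappa>]) simp
    finally show "cmod (cinner (R g) h) \<le> \<eta> * norm x * norm y" by simp
  qed
qed

text \<open>With G = 1 / (n + 1/2 - D) an eigenvector satisfies x = G (t R x), and the equation is
  used twice: (x, x) = (t R x, G x), where the remaining \<open>x\<close> is again of the form G (t
  R x), so \<open>R\<close> stands between two factors \<open>G\<close>.\<close>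

lemma not_half_integer_eigenvalue:
  "\<exists>N. \<forall>n\<ge>N. \<forall>t\<in>{0..1}. \<forall>x\<in>S.
    D x + t *\<^sub>R R x = complex_of_real (real n + 1 / 2) *\<^sub>C x \<longrightarrow> x = 0"
proof -
  \<comment> \<open>Chosen so that \<eta> C < 1, which makes the final estimate for the norm of
    \<open>x\<close> contradictory unless \<open>x = 0\<close>.\<close>
  define \<eta> where "\<eta> = 1 / (C + 1)"
  have \<eta>: "\<eta> > 0" "\<eta> * C < 1" using C_nonneg by (auto simp: \<eta>_def)
  obtain N where N: "\<And>n w g h x y. n \<ge> N \<Longrightarrow> \<forall>i\<ge>1. \<bar>w i\<bar> \<le> 4 / (1 + \<bar>real i - real n\<bar>) \<Longrightarrow>
    \<forall>i\<ge>1. cinner g (e i) = complex_of_real (w i) * cinner x (e i) \<Longrightarrow>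
    \<forall>i\<ge>1. cinner h (e i) = complex_of_real (w i) * cinner y (e i) \<Longrightarrow>
    cmod (cinner (R g) h) \<le> \<eta> * norm x * norm y"
    using sandwich_small[OF \<eta>(1)] by metis
  have "x = 0" if n: "n \<ge> N" and t: "t \<in> {0..1}" and x: "x \<in> S"
    and eq: "D x + t *\<^sub>R R x = complex_of_real (real n + 1 / 2) *\<^sub>C x" for n t x
  proof -
    define w where "w i = 1 / (real n + 1 / 2 - real i)" for i
    \<comment> \<open>The constant 4 is attained at \<open>i = n + 1\<close>.\<close>
    have gap: "1 + \<bar>real i - real n\<bar> \<le> 4 * \<bar>real n + 1 / 2 - real i\<bar>" for i :: nat
    proof (cases i n rule: linorder_cases)
      case greater
      then have "real i - real n \<ge> 1" by simp
      then show ?thesis by simp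
    qed auto
    have w: "\<bar>w i\<bar> \<le> 4 / (1 + \<bar>real i - real n\<bar>)" for i
      unfolding w_def by (rule abs_inverse_le[OF _ gap]) simp
    have x_coord: "cinner x (e i) = complex_of_real (w i) * cinner (t *\<^sub>R R x) (e i)" if "i \<ge> 1" for i
    proof -
      have "cinner (D x + t *\<^sub>R R x) (e i) = complex_of_real (real n + 1 / 2) * cinner x (e i)"
        by (simp only: eq cinner_scaleC_left)
      then have "cinner (t *\<^sub>R R x) (e i) = complex_of_real (real n + 1 / 2 - real i) * cinner x (e i)"
        using eigenbasis_coordinate[OF selfadjoint eigenbasis x that]
        by (simp add: cinner_add_left algebra_simps)
      moreover have "complex_of_real (w i) * complex_of_real (real n + 1 / 2 - real i) = 1"
      proof -
        have "real n + 1 / 2 - real i \<noteq> 0" using gap[of i] by force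
        then have "w i * (real n + 1 / 2 - real i) = 1" by (simp add: w_def)
        then show ?thesis by (metis of_real_mult of_real_1)
      qed
      ultimately show ?thesis
        by (metis mult.assoc mult_1)
    qed
    have w4: "cmod (complex_of_real (w i)) \<le> 4" for i
      using order.trans[OF w[of i], of 4] by (simp add: divide_simps)
    obtain z where z: "\<forall>i\<ge>1. cinner z (e i) = complex_of_real (w i) * cinner x (e i)"
      using riesz_fischer_multiplier[OF basis, of "\<lambda>i. complex_of_real (w i)" 4 x] w4 by blast
    \<comment> \<open>Moves \<open>G\<close> off the first factor; \<open>z\<close> stands for
      \<open>G x\<close>.\<close>
    have "cinner x x = cinner (t *\<^sub>R R x) z"
      by (rule multiplier_adjoint[OF basis x_coord]) (use z in auto)
    also have "\<dots> = complex_of_real t * cnj (cinner (R z) x)"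
      by (metis R_symmetric cinner_commute cinner_scaleR_left)
    finally have "(norm x)\<^sup>2 = cmod (complex_of_real t * cnj (cinner (R z) x))"
      by (metis cinner_self norm_of_real abs_of_nonneg zero_le_power2)
    also have "\<dots> \<le> 1 * cmod (cinner (R z) x)"
      unfolding norm_mult complex_mod_cnj norm_of_real using t by (intro mult_right_mono) auto
    also have "\<dots> \<le> \<eta> * norm x * norm (t *\<^sub>R R x)"
      using N[OF n, of w z x x "t *\<^sub>R R x"] w z x_coord by simp
    also have "\<dots> \<le> \<eta> * norm x * (C * norm x)"
    proof (rule mult_left_mono)
      have "norm (t *\<^sub>R R x) \<le> 1 * norm (R x)"
        unfolding norm_scaleR using t by (intro mult_right_mono) auto
      then show "norm (t *\<^sub>R R x) \<le> C * norm x" using C[of x] by simp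
    qed (use \<eta> in auto)
    finally have "(1 - \<eta> * C) * (norm x)\<^sup>2 \<le> 0"
      by (simp add: power2_eq_square algebra_simps)
    then show "x = 0" using \<eta>(2) by (simp add: mult_le_0_iff)
  qed
  then show ?thesis by blast
qed

text \<open>
  Along the path \<open>D + t R\<close> the eigenvalues move continuously and never cross a large half-integer.
\<close>

lemma eigenvalue_localization:
  assumes f: "eigenbasis f l S (\<lambda>x. D x + R x)"
  shows "\<exists>N. \<forall>n\<ge>N. \<bar>l n - real n\<bar> < 1 / 2"
proof -
  define T where "T t x = D x + t *\<^sub>R R x" for t x
  have T: "selfadjoint_on S (T t)" for t
    unfolding T_def by (intro selfadjoint_on_add_bounded selfadjoint selfadjoint_on_scaleR R)
  have "\<exists>f l. eigenbasis f l S (T t)" for t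
    unfolding T_def
  proof (rule exists_eigenbasis[OF selfadjoint_on_scaleR[OF R]])
    show "norm (t *\<^sub>R R x) \<le> (\<bar>t\<bar> * C) * norm x" for x
      using mult_left_mono[OF C abs_ge_zero, of t x] by (simp add: mult.assoc)
  qed
  then obtain F L where FL: "\<And>t. eigenbasis (F t) (L t) S (T t)" by metis
  have enum: "enumerates_eigenvalues (L t) S (T t)" for t
    by (rule eigenbasis_enumerates[OF T FL])
  have T0: "T 0 = D" and T1: "T 1 = (\<lambda>x. D x + R x)" by (auto simp: T_def)
  \<comment> \<open>\<open>L\<close> results from arbitrary choices of eigenbases; uniqueness of the
    numbering pins down its values at both ends of the path.\<close>
  have L0: "L 0 n = real n" if "n \<ge> 1" for n
    using enumerates_eigenvalues_unique[OF enum[of 0] _ that]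
      eigenbasis_enumerates[OF selfadjoint eigenbasis] by (simp add: T0)
  have L1: "L 1 n = l n" if "n \<ge> 1" for n
    using enumerates_eigenvalues_unique[OF enum[of 1] _ that]
      eigenbasis_enumerates[OF T[of 1, unfolded T1] f] by (simp add: T1)
  have lip: "L t n \<le> L s n + C * \<bar>t - s\<bar>" if "n \<ge> 1" for s t n
  proof (rule eigenvalue_perturbation[OF T FL T FL _ that])
    fix x
    have "T t x - T s x = (t - s) *\<^sub>R R x" by (simp add: T_def scaleR_left_diff_distrib)
    then show "norm (T t x - T s x) \<le> C * \<bar>t - s\<bar> * norm x"
      using mult_left_mono[OF C abs_ge_zero, of "t - s" x] by (simp add: mult_ac)
  qed
  have cont: "continuous_on {0..1} (\<lambda>t. L t n)" if "n \<ge> 1" for n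
  proof (rule lipschitz_on_continuous_on[OF lipschitz_onI])
    show "dist (L t n) (L s n) \<le> C * dist t s" for t s
      using lip[OF that, of t s] lip[OF that, of s t] by (simp add: dist_real_def abs_minus_commute)
  qed (rule C_nonneg)
  obtain N where N: "\<forall>n\<ge>N. \<forall>t\<in>{0..1}. \<forall>x\<in>S.
      T t x = complex_of_real (real n + 1 / 2) *\<^sub>C x \<longrightarrow> x = 0"
    using not_half_integer_eigenvalue unfolding T_def by (rule exE)
  have avoid: "L t n \<noteq> real m + 1 / 2" if "n \<ge> 1" "m \<ge> N" "t \<in> {0..1}" for t n m
  proof
    assume "L t n = real m + 1 / 2"
    then have "F t n \<in> S" "T t (F t n) = complex_of_real (real m + 1 / 2) *\<^sub>C F t n"
      using FL[of t] that(1) by (auto simp: eigenbasis_def)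
    then have "F t n = 0" using N that by blast
    moreover have "norm (F t n) = 1"
      using FL[of t] that(1) orthonormal_norm[OF orthonormal_basis_on[of "F t" "{1..}"]]
      by (simp add: eigenbasis_def)
    ultimately show False by simp
  qed
  \<comment> \<open>The barriers are n + 1/2 and n - 1/2 = (n - 1) + 1/2, so already
    \<open>n - 1\<close> has to be at least \<open>N\<close>.\<close>
  have "\<bar>l n - real n\<bar> < 1 / 2" if n: "n \<ge> N + 1" for n
  proof -
    have n1: "n \<ge> 1" using n by simp
    have "L 1 n < real n + 1 / 2"
    proof (rule ccontr)
      assume "\<not> ?thesis"
      then obtain t where "0 \<le> t" "t \<le> 1" "L t n = real n + 1 / 2"
        using IVT'[of "\<lambda>t. L t n" 0 "real n + 1 / 2" 1] cont[OF n1] L0[OF n1] by auto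
      then show False using avoid[of n n t] n by simp
    qed
    moreover have "real n - 1 / 2 < L 1 n"
    proof (rule ccontr)
      assume "\<not> ?thesis"
      then obtain t where "0 \<le> t" "t \<le> 1" "L t n = real n - 1 / 2"
        using IVT2'[of "\<lambda>t. L t n" 1 "real n - 1 / 2" 0] cont[OF n1] L0[OF n1] by auto
      moreover have "N \<le> n - 1" using n by simp
      ultimately show False using avoid[OF n1, of "n - 1" t] n1 by (simp add: of_nat_diff)
    qed
    ultimately show ?thesis unfolding L1[OF n1] by linarith
  qed
  then show ?thesis by blast
qed

end

section \<open>Eigenvalue asymptotics\<close>

context vanishing_diagonals
begin

text \<open>An infinite sum is 0 by default when it does not converge, so convergence must come
  first: Riesz-Fischer supplies a vector \<open>v\<close> with the expected coordinates, and its
  expansion is the outer sum.\<close>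

lemma K_op_basis:
  assumes n: "n \<ge> 1" and i: "i \<ge> 1"
  shows "cinner (K_op e R (e n)) (e i) =
    (if i = n then 0 else matrix_entry e R i n / (of_nat i - of_nat n))"
proof -
  define k where "k i j = (if i = j then 0 else matrix_entry e R i j / (of_nat i - of_nat j))" for i j
  have inner: "(\<Sum>\<^sub>\<infinity>j\<in>{1..}. k i j * cinner (e n) (e j)) = k i n" for i
  proof -
    have "(\<Sum>\<^sub>\<infinity>j\<in>{1..}. k i j * cinner (e n) (e j)) = (\<Sum>\<^sub>\<infinity>j\<in>{n}. k i j * cinner (e n) (e j))"
      using basis n by (intro infsum_cong_neutral) (auto simp: orthonormal_basis_def)
    also have "\<dots> = k i n" using basis n by (simp add: orthonormal_basis_def)
    finally show ?thesis .
  qed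
  define w where "w i = (if i = n then 0 else 1 / (complex_of_nat i - complex_of_nat n))" for i
  have "cmod (w i) \<le> 1" for i
  proof (cases "i = n")
    case False
    have "complex_of_nat i - complex_of_nat n = complex_of_real (real i - real n)" by simp
    then have "cmod (complex_of_nat i - complex_of_nat n) = \<bar>real i - real n\<bar>"
      by (simp only: norm_of_real real_norm_def)
    moreover have "1 \<le> \<bar>real i - real n\<bar>" using False by (cases i n rule: linorder_cases) auto
    ultimately show ?thesis using False by (simp add: w_def norm_divide divide_simps)
  qed (simp add: w_def)
  then obtain v where v: "\<forall>i\<ge>1. cinner v (e i) = w i * cinner (R (e n)) (e i)"
    using riesz_fischer_multiplier[OF basis, of w 1 "R (e n)"] by blast
  have v_k: "cinner v (e i) = k i n" if "i \<ge> 1" for i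
    using v[rule_format, OF that] by (simp add: w_def k_def matrix_entry_def)
  have "K_op e R (e n) = (\<Sum>\<^sub>\<infinity>i\<in>{1..}. k i n *\<^sub>C e i)"
    unfolding K_op_def k_def[symmetric] inner ..
  also have "\<dots> = (\<Sum>\<^sub>\<infinity>i\<in>{1..}. cinner v (e i) *\<^sub>C e i)"
    by (intro infsum_cong) (simp add: v_k)
  also have "\<dots> = v" by (rule infsumI[OF basis_expansion[OF basis]])
  finally show ?thesis using v_k[OF i] by (simp add: k_def)
qed

lemma norm_K_op_basis:
  assumes n: "n \<ge> 1"
  shows "((\<lambda>k. (cmod (matrix_entry e R k n))\<^sup>2 / (real k - real n)\<^sup>2) has_sum
    (norm (K_op e R (e n)))\<^sup>2) ({1..} - {n})"
proof (rule has_sum_cong_neutral[THEN iffD1, OF _ _ _ parseval_norm[OF basis]])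
  fix k assume "k \<in> {1..} \<inter> ({1..} - {n})"
  then have k: "k \<ge> 1" "k \<noteq> n" by auto
  have "complex_of_nat k - complex_of_nat n = complex_of_real (real k - real n)" by simp
  then have "cmod (complex_of_nat k - complex_of_nat n) = \<bar>real k - real n\<bar>"
    by (simp only: norm_of_real real_norm_def)
  then show "(cmod (cinner (K_op e R (e n)) (e k)))\<^sup>2 = (cmod (matrix_entry e R k n))\<^sup>2 / (real k - real n)\<^sup>2"
    using k by (simp add: K_op_basis[OF n k(1)] norm_divide power_divide)
qed (use K_op_basis[OF n] in auto)

text \<open>
  In the decomposition \<open>x = a e\<^sub>n + v\<close> of an eigenvector, \<open>v = a g + u\<close> with \<open>g = G R e\<^sub>n\<close> and
  \<open>u = G R v\<close>, where \<open>G\<close> is the reduced resolvent of \<open>D\<close> at the eigenvalue of \<open>D + R\<close>. Since \<open>G R G\<close>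
  is small, \<open>v\<close> is at most of the order of \<open>g\<close>, that is, of \<open>K e\<^sub>n\<close>.
\<close>

lemma eigenvalue_first_order:
  "\<exists>N. \<forall>n\<ge>N. \<forall>w g x \<mu>. (\<forall>i\<ge>1. \<bar>w i\<bar> \<le> 4 / (1 + \<bar>real i - real n\<bar>)) \<longrightarrow> w n = 0 \<longrightarrow>
    (\<forall>i\<ge>1. cinner g (e i) = complex_of_real (w i) * cinner (R (e n)) (e i)) \<longrightarrow>
    x \<noteq> 0 \<longrightarrow> (\<forall>i\<ge>1. i \<noteq> n \<longrightarrow> cinner x (e i) = complex_of_real (w i) * cinner (R x) (e i)) \<longrightarrow>
    cinner (R x) (e n) = \<mu> * cinner x (e n) \<longrightarrow>
    cmod (\<mu> - matrix_entry e R n n - cinner g (R (e n))) \<le> C * (8 * C + 2) * (norm g)\<^sup>2"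
proof -
  \<comment> \<open>With \<eta> C at most 1/2 the term quadratic in the norm of \<open>u\<close> can
    be absorbed on the left-hand side.\<close>
  define \<eta> where "\<eta> = 1 / (2 * (C + 1))"
  have \<eta>: "\<eta> > 0" "\<eta> * C \<le> 1 / 2" using C_nonneg by (auto simp: \<eta>_def divide_simps)
  obtain N where N: "\<And>n w g h x y. n \<ge> N \<Longrightarrow> \<forall>i\<ge>1. \<bar>w i\<bar> \<le> 4 / (1 + \<bar>real i - real n\<bar>) \<Longrightarrow>
    \<forall>i\<ge>1. cinner g (e i) = complex_of_real (w i) * cinner x (e i) \<Longrightarrow>
    \<forall>i\<ge>1. cinner h (e i) = complex_of_real (w i) * cinner y (e i) \<Longrightarrow>
    cmod (cinner (R g) h) \<le> \<eta> * norm x * norm y"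
    using sandwich_small[OF \<eta>(1)] by metis
  show ?thesis
  proof (intro exI[of _ "N + 1"] allI impI)
    fix n and w :: "nat \<Rightarrow> real" and g x \<mu>
    assume n: "N + 1 \<le> n" and w: "\<forall>i\<ge>1. \<bar>w i\<bar> \<le> 4 / (1 + \<bar>real i - real n\<bar>)" "w n = 0"
      and g: "\<forall>i\<ge>1. cinner g (e i) = complex_of_real (w i) * cinner (R (e n)) (e i)"
      and x0: "x \<noteq> 0" and x: "\<forall>i\<ge>1. i \<noteq> n \<longrightarrow> cinner x (e i) = complex_of_real (w i) * cinner (R x) (e i)"
      and \<mu>: "cinner (R x) (e n) = \<mu> * cinner x (e n)"
    define a where "a = cinner x (e n)"
    define v where "v = x - a *\<^sub>C e n"
    define u where "u = v - a *\<^sub>C g"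
    have Rx: "R x = a *\<^sub>C R (e n) + R v"
      by (simp add: v_def R_diff R_scaleC)
    have e_coord: "cinner (e n) (e i) = (if i = n then 1 else 0)" if "i \<ge> 1" for i
      using basis n that by (auto simp: orthonormal_basis_def)
    have v_coord: "cinner v (e i) = complex_of_real (w i) * cinner (R x) (e i)" if "i \<ge> 1" for i
      using x w(2) that by (cases "i = n")
        (auto simp: v_def cinner_diff_left cinner_scaleC_left e_coord a_def)
    have u_coord: "cinner u (e i) = complex_of_real (w i) * cinner (R v) (e i)" if "i \<ge> 1" for i
      using g[rule_format, OF that]
      by (simp add: u_def cinner_diff_left cinner_scaleC_left v_coord[OF that] Rx cinner_add_left algebra_simps)
    have w4: "\<bar>w i\<bar> \<le> 4" if "i \<ge> 1" for i
    proof -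
      have "4 / (1 + \<bar>real i - real n\<bar>) \<le> 4" by (simp add: divide_simps)
      then show ?thesis using w(1) that by (meson order.trans)
    qed
    then have "\<And>i. i \<ge> 1 \<Longrightarrow> cmod (complex_of_real (w i)) \<le> 4" by simp
    then obtain z where z: "\<forall>i\<ge>1. cinner z (e i) = complex_of_real (w i) * cinner u (e i)"
      using riesz_fischer_multiplier[OF basis, of "\<lambda>i. complex_of_real (w i)" 4 u] by blast
    have z_norm: "norm z \<le> 4 * norm u"
      by (rule norm_le_coordinates[OF basis])
        (use w4 in \<open>auto simp: z norm_mult intro: mult_right_mono\<close>)
    have v_eq: "v = a *\<^sub>C g + u" by (simp add: u_def)
    have Rv: "R v = a *\<^sub>C R g + R u" by (simp add: v_eq R_add R_scaleC)
    define b where "b = cmod a * norm g"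
    have "b \<ge> 0" by (simp add: b_def)
    have v_le: "norm v \<le> b + norm u"
      unfolding v_eq b_def using norm_triangle_ineq[of "a *\<^sub>C g" u] by (simp add: norm_scaleC)
    \<comment> \<open>Here \<open>z\<close> is \<open>G u\<close>. Splitting R v = a R g + R u
      leaves a term that is small because of \<open>g\<close> and the term (R u, G u), in which
      \<open>u\<close> is again G (R v): the sandwich estimate applies.\<close>
    have "cinner u u = cinner (R v) z"
      by (rule multiplier_adjoint[OF basis u_coord]) (use z in auto)
    also have "\<dots> = a * cinner (R g) z + cnj (cinner (R z) u)"
      by (simp add: Rv cinner_add_left cinner_scaleC_left)
        (metis R_symmetric cinner_commute)
    finally have "(norm u)\<^sup>2 \<le> cmod a * cmod (cinner (R g) z) + cmod (cinner (R z) u)"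
      by (metis cinner_self norm_of_real abs_of_nonneg zero_le_power2 norm_triangle_ineq norm_mult complex_mod_cnj)
    also have "cmod a * cmod (cinner (R g) z) \<le> cmod a * (C * norm g * (4 * norm u))"
      using C_nonneg by (intro mult_left_mono order.trans[OF cinner_R_le] z_norm) auto
    also have "cmod (cinner (R z) u) \<le> \<eta> * norm u * norm (R v)"
      using N[of n w z u u "R v"] n w(1) z u_coord by auto
    also have "\<eta> * norm u * norm (R v) \<le> \<eta> * norm u * (C * (b + norm u))"
      using \<eta>(1) C_nonneg v_le
      by (intro mult_left_mono order.trans[OF C]) auto
    also have "\<dots> = (\<eta> * C) * (norm u * (b + norm u))" by simp
    also have "\<dots> \<le> 1 / 2 * (norm u * (b + norm u))"
      using \<open>b \<ge> 0\<close> by (intro mult_right_mono \<eta>(2)) auto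
    \<comment> \<open>Twice the bound 4 C b + b/2, once half of the square of the norm of
      \<open>u\<close> has moved to the left.\<close>
    finally have "norm u * norm u \<le> norm u * ((8 * C + 1) * b)"
      by (simp add: b_def power2_eq_square algebra_simps)
    then have u_le: "norm u \<le> (8 * C + 1) * b"
      using C_nonneg \<open>b \<ge> 0\<close> by (cases "u = 0") (auto simp: mult_le_cancel_left)
    have v_le': "norm v \<le> (8 * C + 2) * b"
      using v_le u_le by (simp add: algebra_simps)
    \<comment> \<open>If the component along \<open>e n\<close> vanished, so would \<open>b\<close>,
      hence \<open>v\<close> and the whole eigenvector.\<close>
    have "a \<noteq> 0"
    proof
      assume "a = 0"
      then have "norm v \<le> 0" using v_le' by (simp add: b_def)
      then show False using x0 \<open>a = 0\<close> by (simp add: v_def)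
    qed
    \<comment> \<open>The symmetry of both \<open>R\<close> and \<open>G\<close> turns the
      contribution of \<open>u\<close> into (R v, g), which is quadratic in the norm of
      \<open>g\<close> after division by \<open>a\<close>.\<close>
    have "\<mu> * a = a * matrix_entry e R n n + (a * cinner g (R (e n)) + cinner (R v) g)"
    proof -
      have "cinner (R v) (e n) = a * cinner g (R (e n)) + cinner u (R (e n))"
        by (simp add: R_symmetric v_eq cinner_add_left cinner_scaleC_left)
      moreover have "cinner u (R (e n)) = cinner (R v) g"
        by (rule multiplier_adjoint[OF basis u_coord]) (use g in auto)
      ultimately show ?thesis
        using \<mu> by (simp add: a_def[symmetric] Rx cinner_add_left cinner_scaleC_left matrix_entry_def)
    qed
    then have "a * (\<mu> - matrix_entry e R n n - cinner g (R (e n))) = cinner (R v) g"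
      by (simp add: algebra_simps)
    then have "cmod a * cmod (\<mu> - matrix_entry e R n n - cinner g (R (e n))) = cmod (cinner (R v) g)"
      by (metis norm_mult)
    also have "\<dots> \<le> C * norm v * norm g" by (rule cinner_R_le)
    also have "\<dots> \<le> C * ((8 * C + 2) * b) * norm g"
      using C_nonneg by (intro mult_right_mono mult_left_mono v_le') auto
    also have "\<dots> = cmod a * (C * (8 * C + 2) * (norm g)\<^sup>2)"
      by (simp add: b_def power2_eq_square)
    finally show "cmod (\<mu> - matrix_entry e R n n - cinner g (R (e n))) \<le> C * (8 * C + 2) * (norm g)\<^sup>2"
      using \<open>a \<noteq> 0\<close> by (simp add: mult_le_cancel_left)
  qed
qed

text \<open>The first-order formula is applied with weights 1 / (l n - i), for which
  \<open>g\<close> is bounded by twice \<open>K e_n\<close>; then the eigenvalue in the denominators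
  is replaced by \<open>n\<close>.\<close>

lemma eigenvalue_asymptotics:
  assumes f: "eigenbasis f l S (\<lambda>x. D x + R x)"
  shows "\<exists>K N. \<forall>n\<ge>N. \<bar>l n - (real n + Re (matrix_entry e R n n) +
    (\<Sum>\<^sub>\<infinity>k\<in>{1..} - {n}. (cmod (matrix_entry e R n k))\<^sup>2 / (real n - real k)))\<bar>
    \<le> K * (norm (K_op e R (e n)))\<^sup>2"
proof -
  obtain N1 where N1: "\<And>n. n \<ge> N1 \<Longrightarrow> \<bar>l n - real n\<bar> < 1 / 2"
    using eigenvalue_localization[OF f] by blast
  obtain N2 where N2: "\<And>n w g x \<mu>. n \<ge> N2 \<Longrightarrow> \<forall>i\<ge>1. \<bar>w i\<bar> \<le> 4 / (1 + \<bar>real i - real n\<bar>) \<Longrightarrow> w n = 0 \<Longrightarrow>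
    \<forall>i\<ge>1. cinner g (e i) = complex_of_real (w i) * cinner (R (e n)) (e i) \<Longrightarrow>
    x \<noteq> 0 \<Longrightarrow> \<forall>i\<ge>1. i \<noteq> n \<longrightarrow> cinner x (e i) = complex_of_real (w i) * cinner (R x) (e i) \<Longrightarrow>
    cinner (R x) (e n) = \<mu> * cinner x (e n) \<Longrightarrow>
    cmod (\<mu> - matrix_entry e R n n - cinner g (R (e n))) \<le> C * (8 * C + 2) * (norm g)\<^sup>2"
    using eigenvalue_first_order by metis
  \<comment> \<open>A number, not the operator: the factor 4 is the square of the 2 in
    \<open>norm g \<le> 2 * k\<close>, and the 1 pays for replacing \<open>l n\<close> by
    \<open>n\<close>.\<close>
  define K where "K = 4 * (C * (8 * C + 2)) + 1"
  have "\<bar>l n - (real n + Re (matrix_entry e R n n) +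
    (\<Sum>\<^sub>\<infinity>k\<in>{1..} - {n}. (cmod (matrix_entry e R n k))\<^sup>2 / (real n - real k)))\<bar>
    \<le> K * (norm (K_op e R (e n)))\<^sup>2" if n: "n \<ge> N1 + N2 + 1" for n
  proof -
    have n1: "n \<ge> 1" using n by simp
    have close: "\<bar>l n - real n\<bar> < 1 / 2" using N1 n by simp
    define k where "k = norm (K_op e R (e n))"
    define r where "r i = cmod (cinner (R (e n)) (e i))" for i
    define w where "w i = (if i = n then 0 else 1 / (l n - real i))" for i
    define w' where "w' i = (if i = n then 0 else 1 / (real n - real i))" for i
    have far: "1 \<le> \<bar>real i - real n\<bar>" if "i \<noteq> n" for i :: nat
      using that by (cases i n rule: linorder_cases) auto
    have gap: "1 + \<bar>real i - real n\<bar> \<le> 4 * \<bar>l n - real i\<bar>" "\<bar>real i - real n\<bar> \<le> 2 * \<bar>l n - real i\<bar>"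
      if "i \<noteq> n" for i :: nat
    proof -
      have "\<bar>real i - real n\<bar> \<le> \<bar>l n - real i\<bar> + \<bar>l n - real n\<bar>" by arith
      moreover have "1 + a \<le> 4 * b \<and> a \<le> 2 * b" if "a \<le> b + d" "1 \<le> a" "d < 1 / 2" for a b d :: real
        using that by linarith
      ultimately show "1 + \<bar>real i - real n\<bar> \<le> 4 * \<bar>l n - real i\<bar>"
        and "\<bar>real i - real n\<bar> \<le> 2 * \<bar>l n - real i\<bar>"
        using far[OF that] close by blast+
    qed
    have w: "\<bar>w i\<bar> \<le> 4 / (1 + \<bar>real i - real n\<bar>)" for i
    proof (cases "i = n")
      case False
      then show ?thesis using abs_inverse_le[OF _ gap(1)[OF False]] by (simp add: w_def)
    qed (simp add: w_def)
    have w2: "\<bar>w i\<bar> \<le> 2 / \<bar>real i - real n\<bar>" for i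
    proof (cases "i = n")
      case False
      then show ?thesis using abs_inverse_le[OF _ gap(2)[OF False]] by (simp add: w_def)
    qed (simp add: w_def)
    have w_bound: "cmod (complex_of_real (w i)) \<le> 4" "cmod (complex_of_real (w' i)) \<le> 1" for i
    proof -
      show "cmod (complex_of_real (w i)) \<le> 4"
        using order.trans[OF w[of i], of 4] by (simp add: divide_simps)
      show "cmod (complex_of_real (w' i)) \<le> 1"
        unfolding norm_of_real w'_def using abs_inverse_le[of 1 1 "real n - real i"] far[of i]
        by (cases "i = n") (auto simp: abs_minus_commute)
    qed
    obtain g where g: "\<forall>i\<ge>1. cinner g (e i) = complex_of_real (w i) * cinner (R (e n)) (e i)"
      using riesz_fischer_multiplier[OF basis, of "\<lambda>i. complex_of_real (w i)" 4 "R (e n)"] w_bound(1) by blast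
    obtain g' where g': "\<forall>i\<ge>1. cinner g' (e i) = complex_of_real (w' i) * cinner (R (e n)) (e i)"
      using riesz_fischer_multiplier[OF basis, of "\<lambda>i. complex_of_real (w' i)" 1 "R (e n)"] w_bound(2) by blast
    have K_coord: "cmod (cinner (K_op e R (e n)) (e i)) = (if i = n then 0 else r i / \<bar>real i - real n\<bar>)"
      if "i \<ge> 1" for i
    proof -
      have "complex_of_nat i - complex_of_nat n = complex_of_real (real i - real n)" by simp
      then have "cmod (complex_of_nat i - complex_of_nat n) = \<bar>real i - real n\<bar>"
        by (simp only: norm_of_real real_norm_def)
      then show ?thesis by (simp add: K_op_basis[OF n1 that] norm_divide r_def matrix_entry_def)
    qed
    have g_norm: "norm g \<le> 2 * k"
      unfolding k_def
    proof (rule norm_le_coordinates[OF basis])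
      fix i :: nat assume i: "i \<ge> 1"
      show "cmod (cinner g (e i)) \<le> 2 * cmod (cinner (K_op e R (e n)) (e i))"
      proof (cases "i = n")
        case True
        then show ?thesis using g[rule_format, OF i] by (simp add: w_def)
      next
        case False
        have "\<bar>w i\<bar> * r i \<le> 2 / \<bar>real i - real n\<bar> * r i"
          by (intro mult_right_mono w2) (simp add: r_def)
        then show ?thesis using False by (simp add: g[rule_format, OF i] K_coord[OF i] norm_mult r_def)
      qed
    qed simp
    have fn: "f n \<in> S" "D (f n) + R (f n) = complex_of_real (l n) *\<^sub>C f n" "f n \<noteq> 0"
      using f n1 orthonormal_norm[OF orthonormal_basis_on[of f "{1..}"], of n]
      by (auto simp: eigenbasis_def)
    have eq: "cinner (R (f n)) (e i) = complex_of_real (l n - real i) * cinner (f n) (e i)" if "i \<ge> 1" for i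
    proof -
      have "cinner (D (f n)) (e i) + cinner (R (f n)) (e i) = complex_of_real (l n) * cinner (f n) (e i)"
        using fn(2) by (metis cinner_add_left cinner_scaleC_left)
      then show ?thesis
        using eigenbasis_coordinate[OF selfadjoint eigenbasis fn(1) that] by (simp add: algebra_simps)
    qed
    have "cmod (complex_of_real (l n - real n) - matrix_entry e R n n - cinner g (R (e n)))
        \<le> C * (8 * C + 2) * (norm g)\<^sup>2"
    proof (rule N2[OF _ _ _ g fn(3)])
      show "\<forall>i\<ge>1. i \<noteq> n \<longrightarrow> cinner (f n) (e i) = complex_of_real (w i) * cinner (R (f n)) (e i)"
      proof (intro allI impI)
        fix i :: nat assume i: "i \<ge> 1" "i \<noteq> n"
        have "l n - real i \<noteq> 0" using gap(1)[OF i(2)] by force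
        then have "w i * (l n - real i) = 1" using i by (simp add: w_def)
        then have "complex_of_real (w i) * complex_of_real (l n - real i) = 1"
          by (metis of_real_mult of_real_1)
        then show "cinner (f n) (e i) = complex_of_real (w i) * cinner (R (f n)) (e i)"
          unfolding eq[OF i(1)] by (metis mult.assoc mult_1)
      qed
    qed (use n w eq[OF n1] in \<open>auto simp: w_def\<close>)
    also have "\<dots> \<le> C * (8 * C + 2) * (2 * k)\<^sup>2"
      using C_nonneg g_norm by (intro mult_left_mono power_mono) auto
    finally have "\<bar>Re (complex_of_real (l n - real n) - matrix_entry e R n n - cinner g (R (e n)))\<bar>
        \<le> C * (8 * C + 2) * (2 * k)\<^sup>2"
      using abs_Re_le_cmod order.trans by blast
    then have first: "\<bar>l n - real n - Re (matrix_entry e R n n) - Re (cinner g (R (e n)))\<bar>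
        \<le> 4 * (C * (8 * C + 2)) * k\<^sup>2"
      by (simp add: power_mult_distrib algebra_simps)
    have sum_g: "((\<lambda>i. w i * (r i)\<^sup>2) has_sum Re (cinner g (R (e n)))) {1..}"
      unfolding r_def by (rule multiplier_form[OF basis]) (use g in auto)
    have sum_g': "((\<lambda>i. w' i * (r i)\<^sup>2) has_sum Re (cinner g' (R (e n)))) {1..}"
      unfolding r_def by (rule multiplier_form[OF basis]) (use g' in auto)
    have sum_k: "((\<lambda>i. (cmod (cinner (K_op e R (e n)) (e i)))\<^sup>2) has_sum k\<^sup>2) {1..}"
      unfolding k_def by (rule parseval_norm[OF basis])
    \<comment> \<open>The difference of the weights is (n - l n) times their product, at most 1/2 *
      2/|i - n| * 1/|i - n|: exactly one term of the series for the squared norm of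
      \<open>K e_n\<close>.\<close>
    have diff: "\<bar>w i * (r i)\<^sup>2 - w' i * (r i)\<^sup>2\<bar> \<le> (cmod (cinner (K_op e R (e n)) (e i)))\<^sup>2" if i: "i \<ge> 1" for i
    proof (cases "i = n")
      case True
      then show ?thesis by (simp add: w_def w'_def)
    next
      case False
      have nz: "l n - real i \<noteq> 0" "real n - real i \<noteq> 0" using gap(1)[OF False] False by force+
      have "w i - w' i = (real n - l n) * w i * w' i"
        using nz False by (simp add: w_def w'_def field_simps)
      then have "\<bar>w i - w' i\<bar> = \<bar>l n - real n\<bar> * \<bar>w i\<bar> * (1 / \<bar>real i - real n\<bar>)"
        using False by (simp add: abs_mult w'_def abs_minus_commute)
      also have "\<dots> \<le> 1 / 2 * (2 / \<bar>real i - real n\<bar>) * (1 / \<bar>real i - real n\<bar>)"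
        using close by (intro mult_right_mono mult_mono w2) auto
      finally have "\<bar>w i - w' i\<bar> \<le> 1 / (real i - real n)\<^sup>2"
        by (simp add: power2_eq_square)
      then have "\<bar>w i - w' i\<bar> * (r i)\<^sup>2 \<le> 1 / (real i - real n)\<^sup>2 * (r i)\<^sup>2"
        by (rule mult_right_mono) simp
      then show ?thesis
        using False by (simp add: K_coord[OF i] power_divide abs_mult flip: left_diff_distrib)
    qed
    have d: "((\<lambda>i. w i * (r i)\<^sup>2 - w' i * (r i)\<^sup>2) has_sum Re (cinner g (R (e n))) - Re (cinner g' (R (e n)))) {1..}"
      using has_sum_add[OF sum_g has_sum_uminusI[OF sum_g']] by simp
    have "Re (cinner g (R (e n))) - Re (cinner g' (R (e n))) \<le> k\<^sup>2"
      by (rule has_sum_mono[OF d sum_k]) (use diff in force)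
    moreover have "- (k\<^sup>2) \<le> Re (cinner g (R (e n))) - Re (cinner g' (R (e n)))"
      by (rule has_sum_mono[OF has_sum_uminusI[OF sum_k] d]) (use diff in force)
    ultimately have second: "\<bar>Re (cinner g (R (e n))) - Re (cinner g' (R (e n)))\<bar> \<le> k\<^sup>2"
      by linarith
    have "((\<lambda>i. (cmod (matrix_entry e R n i))\<^sup>2 / (real n - real i)) has_sum Re (cinner g' (R (e n)))) ({1..} - {n})"
    proof (rule has_sum_cong_neutral[THEN iffD1, OF _ _ _ sum_g'])
      fix i assume "i \<in> {1..} \<inter> ({1..} - {n})"
      \<comment> \<open>The claim uses row \<open>n\<close>, \<open>r\<close> comes from column
        \<open>n\<close>; selfadjointness identifies the absolute values.\<close>
      moreover have "cmod (matrix_entry e R n i) = r i"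
        unfolding matrix_entry_def r_def R_symmetric[of "e i"] by (metis cinner_commute complex_mod_cnj)
      ultimately show "w' i * (r i)\<^sup>2 = (cmod (matrix_entry e R n i))\<^sup>2 / (real n - real i)"
        by (simp add: w'_def)
    qed (auto simp: w'_def)
    then have "(\<Sum>\<^sub>\<infinity>i\<in>{1..} - {n}. (cmod (matrix_entry e R n i))\<^sup>2 / (real n - real i)) = Re (cinner g' (R (e n)))"
      by (rule infsumI)
    then show ?thesis
      using first second unfolding K_def k_def[symmetric] by (simp add: distrib_right)
  qed
  then show ?thesis by blast
qed

end

theorem theorem3p3:
  fixes D R :: "'a::chilbert_space \<Rightarrow> 'a" and domD :: "'a set" and e :: "nat \<Rightarrow> 'a"
  assumes "selfadjoint_on domD D"
    and "orthonormal_basis e"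
    and "\<And>n. n \<ge> 1 \<Longrightarrow> e n \<in> domD \<and> D (e n) = of_nat n *\<^sub>C e n"
    and "bounded_linear R" and "selfadjoint_on UNIV R" and "\<not> compact_operator R"
    and "\<And>p::int. (\<lambda>n. matrix_entry e R n (nat (int n + p))) \<longlonglongrightarrow> 0"
  shows "selfadjoint_on domD (\<lambda>x. D x + R x) \<and>
    has_discrete_spectrum domD (\<lambda>x. D x + R x) \<and>
    (\<forall>n\<ge>1. (norm (K_op e R (e n)))\<^sup>2 =
       (\<Sum>\<^sub>\<infinity>k\<in>{1..} - {n}. (cmod (matrix_entry e R k n))\<^sup>2 / (real k - real n)\<^sup>2)) \<and>
    (\<exists>l. enumerates_eigenvalues l domD (\<lambda>x. D x + R x)) \<and>
    (\<forall>l. enumerates_eigenvalues l domD (\<lambda>x. D x + R x) \<longrightarrow>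
      (\<exists>\<Delta> :: nat \<Rightarrow> real. (\<forall>n. \<Delta> n \<ge> 0) \<and>
        (\<lambda>n. (\<Delta> n)\<^sup>2) \<in> O(\<lambda>n. \<Sum>\<^sub>\<infinity>m\<in>{1..}.
           (cmod (matrix_entry e R m m) + norm (K_op e R (e m)))\<^sup>2 /
           (norm (D (e m) - of_nat n *\<^sub>C e m - (1/2) *\<^sub>C E_op e n (e m)))\<^sup>2) \<and>
        (\<lambda>n. l n - (real n + Re (matrix_entry e R n n) +
             (\<Sum>\<^sub>\<infinity>k\<in>{1..} - {n}. (cmod (matrix_entry e R n k))\<^sup>2 / (real n - real k))))
          \<in> O(\<lambda>n. (\<Delta> n + norm (K_op e R (e n))) *
                    (cmod (matrix_entry e R n n) + norm (K_op e R (e n))))))"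
proof -
  obtain C where C: "\<And>x. norm (R x) \<le> C * norm x"
    using bounded_linear.bounded[OF assms(4)] by (metis mult.commute)
  interpret vanishing_diagonals domD D e R C
    by unfold_locales (use assms(1-3,5,7) C in auto)
  let ?T = "\<lambda>x. D x + R x"
  have T: "selfadjoint_on domD ?T"
    by (rule selfadjoint_on_add_bounded[OF assms(1,5)])
  obtain f l0 where f: "eigenbasis f l0 domD ?T"
    using exists_eigenbasis[OF assms(5) C] by blast
  obtain K N where K: "\<And>n. n \<ge> N \<Longrightarrow> \<bar>l0 n - (real n + Re (matrix_entry e R n n) +
    (\<Sum>\<^sub>\<infinity>k\<in>{1..} - {n}. (cmod (matrix_entry e R n k))\<^sup>2 / (real n - real k)))\<bar>
    \<le> K * (norm (K_op e R (e n)))\<^sup>2"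
    using eigenvalue_asymptotics[OF f] by blast
  show ?thesis
  proof (intro conjI allI impI)
    show "selfadjoint_on domD ?T" by (rule T)
    show "has_discrete_spectrum domD ?T" by (rule eigenbasis_discrete_spectrum[OF T f])
    show "\<exists>l. enumerates_eigenvalues l domD ?T" using eigenbasis_enumerates[OF T f] by blast
    show "(norm (K_op e R (e n)))\<^sup>2 =
       (\<Sum>\<^sub>\<infinity>k\<in>{1..} - {n}. (cmod (matrix_entry e R k n))\<^sup>2 / (real k - real n)\<^sup>2)" if "n \<ge> 1" for n
      using infsumI[OF norm_K_op_basis[OF that]] by simp
    fix l assume l: "enumerates_eigenvalues l domD ?T"
    have l_eq: "l n = l0 n" if "n \<ge> 1" for n
      by (rule enumerates_eigenvalues_unique[OF l eigenbasis_enumerates[OF T f] that])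
    show "\<exists>\<Delta> :: nat \<Rightarrow> real. (\<forall>n. \<Delta> n \<ge> 0) \<and>
        (\<lambda>n. (\<Delta> n)\<^sup>2) \<in> O(\<lambda>n. \<Sum>\<^sub>\<infinity>m\<in>{1..}.
           (cmod (matrix_entry e R m m) + norm (K_op e R (e m)))\<^sup>2 /
           (norm (D (e m) - of_nat n *\<^sub>C e m - (1/2) *\<^sub>C E_op e n (e m)))\<^sup>2) \<and>
        (\<lambda>n. l n - (real n + Re (matrix_entry e R n n) +
             (\<Sum>\<^sub>\<infinity>k\<in>{1..} - {n}. (cmod (matrix_entry e R n k))\<^sup>2 / (real n - real k))))
          \<in> O(\<lambda>n. (\<Delta> n + norm (K_op e R (e n))) *
                    (cmod (matrix_entry e R n n) + norm (K_op e R (e n))))"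
    \<comment> \<open>The remaining bound is the product of the norm of \<open>K e_n\<close> with
      itself plus |R_nn|, which dominates the square supplied by the asymptotics.\<close>
    proof (intro exI[of _ "\<lambda>_. 0"] conjI allI)
      show "(\<lambda>n. l n - (real n + Re (matrix_entry e R n n) +
             (\<Sum>\<^sub>\<infinity>k\<in>{1..} - {n}. (cmod (matrix_entry e R n k))\<^sup>2 / (real n - real k))))
          \<in> O(\<lambda>n. (0 + norm (K_op e R (e n))) *
                    (cmod (matrix_entry e R n n) + norm (K_op e R (e n))))"
      \<comment> \<open>The absolute value is taken because the sign of the obtained
        \<open>K\<close> is unknown.\<close>
      proof (rule bigoI[where c = "\<bar>K\<bar>"])
        show "\<forall>\<^sub>F n in sequentially. norm (l n - (real n + Re (matrix_entry e R n n) +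
             (\<Sum>\<^sub>\<infinity>k\<in>{1..} - {n}. (cmod (matrix_entry e R n k))\<^sup>2 / (real n - real k))))
          \<le> \<bar>K\<bar> * norm ((0 + norm (K_op e R (e n))) *
                    (cmod (matrix_entry e R n n) + norm (K_op e R (e n))))"
          \<comment> \<open>The 1 excludes index 0, where the two enumerations need not
            agree.\<close>
          using eventually_ge_at_top[of "N + 1"]
        proof eventually_elim
          case (elim n)
          let ?k = "norm (K_op e R (e n))"
          have "norm (l n - (real n + Re (matrix_entry e R n n) +
             (\<Sum>\<^sub>\<infinity>k\<in>{1..} - {n}. (cmod (matrix_entry e R n k))\<^sup>2 / (real n - real k)))) \<le> K * ?k\<^sup>2"
            using K[of n] elim l_eq[of n] by simp
          also have "\<dots> \<le> \<bar>K\<bar> * (?k * (cmod (matrix_entry e R n n) + ?k))"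
            by (intro mult_mono) (auto simp: power2_eq_square intro: mult_left_mono)
          finally show ?case by simp
        qed
      qed
    qed auto
  qed
qed

end
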